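(* (1) The descent set statistic $\mathrm{Des}$ is shuffle-compatible on words. (2) The linear map on $\mathcal{A}^{W}_{\mathrm{Des}}$ defined by $[\alpha]^W_{\mathrm{Des}}\mapsto F_{\mathrm{Comp}(\mathrm{Des}(\alpha))}$ is an algebra isomorphism between $\mathcal{A}^{W}_{\mathrm{Des}}$ and $\mathrm{QSym}$.
   Context: All algebras are over $\mathbb{Q}$. A word of length $n\ge0$ is a sequence $\alpha=(\alpha_1,\dots,\alpha_n)$ of positive integers; $|\alpha|=n$; $W$ is the set of all words. If the distinct letters of $\alpha$ are $a_1<\dots<a_k$, then $\mathrm{pack}(\alpha)$ is obtained by replacing each $a_i$ by $i$. Two words are disjoint if they have no common letter. $\mathrm{Sh}(\alpha,\beta)$ is the multiset of all $\binom{|\alpha|+|\beta|}{|\alpha|}$ interleavings (shuffles) of $\alpha$ and $\beta$. The descent set of $\alpha\in W$ of length $n$ is $\mathrm{Des}(\alpha)=\{i\in[n-1]:\alpha_i>\alpha_{i+1}\}$. A statistic $\mathrm{st}$ (function on $W$) is shuffle-compatible on words if (i) for all disjoint words $\alpha,\beta$ the multiset $\{\{\mathrm{st}(\gamma):\gamma\in \mathrm{Sh}(\alpha,\beta)\}\}$ is determined by $|\alpha|,|\beta|,\mathrm{st}(\alpha),\mathrm{st}(\beta)$; and (ii) $\mathrm{pack}(\alpha)=\mathrm{pack}(\beta)$ implies $\mathrm{st}(\alpha)=\mathrm{st}(\beta)$. Let $[\alpha]^W_{\mathrm{st}}=\{\beta\in W:\mathrm{st}(\beta)=\mathrm{st}(\alpha),|\beta|=|\alpha|\}$.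 $\mathcal{A}^W_{\mathrm{st}}$ is the algebra with basis these classes and product $[\alpha]^W_{\mathrm{st}}[\beta]^W_{\mathrm{st}}=\sum_{\gamma\in \mathrm{Sh}(\alpha,\beta)}[\gamma]^W_{\mathrm{st}}$, for disjoint representatives $\alpha,\beta$. For $S=\{s_1<\dots<s_k\}\subseteq[n-1]$, $\mathrm{Comp}(S)=(s_1,s_2-s_1,\dots,s_k-s_{k-1},n-s_k)$, a composition of $n$ (here $n=|\alpha|$; the empty composition if $n=0$). $\mathrm{QSym}$ is the algebra of quasisymmetric functions over $\mathbb{Q}$ in $x_1,x_2,\dots$, and $F_{\mathrm{Comp}(S)}=\sum x_{i_1}x_{i_2}\cdots x_{i_n}$, the sum over $i_1\le i_2\le\dots\le i_n$ with $i_j<i_{j+1}$ for $j\in S$, is the fundamental basis. *)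

theory Defs
  imports Complex_Main "HOL-Algebra.Module" "HOL-Algebra.QuotRing"
    "HOL-Library.Multiset" "HOL-Library.Poly_Mapping"
begin

section \<open>Words, shuffles and statistics\<close>

type_synonym word = "nat list"

definition words :: "word set" where
  "words = {\<alpha>. \<forall>a \<in> set \<alpha>. 0 < a}"

text \<open>The letter \<open>a\<close> is the \<open>i\<close>-th smallest letter of \<open>\<alpha>\<close> iff exactly \<open>i\<close> letters
  of \<open>\<alpha>\<close> are at most \<open>a\<close>.\<close>

definition pack :: "word \<Rightarrow> word" where
  "pack \<alpha> = map (\<lambda>a. card {b \<in> set \<alpha>. b \<le> a}) \<alpha>"

definition disjoint_words :: "word \<Rightarrow> word \<Rightarrow> bool" where
  "disjoint_words \<alpha> \<beta> \<longleftrightarrow> set \<alpha> \<inter> set \<beta> = {}"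

text \<open>Unlike \<^const>\<open>shuffles\<close>, this counts interleavings with multiplicity.\<close>

fun Sh :: "'a list \<Rightarrow> 'a list \<Rightarrow> 'a list multiset" where
  "Sh [] \<beta> = {#\<beta>#}"
| "Sh \<alpha> [] = {#\<alpha>#}"
| "Sh (a # \<alpha>) (b # \<beta>) =
     image_mset ((#) a) (Sh \<alpha> (b # \<beta>)) + image_mset ((#) b) (Sh (a # \<alpha>) \<beta>)"

lemma size_Sh: "size (Sh \<alpha> \<beta>) = (length \<alpha> + length \<beta>) choose length \<alpha>"
  by (induction \<alpha> \<beta> rule: Sh.induct) (simp_all add: add_ac)

lemma length_Sh: "\<gamma> \<in># Sh \<alpha> \<beta> \<Longrightarrow> length \<gamma> = length \<alpha> + length \<beta>"
  by (induction \<alpha> \<beta> arbitrary: \<gamma> rule: Sh.induct) auto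

lemma set_Sh: "\<gamma> \<in># Sh \<alpha> \<beta> \<Longrightarrow> set \<gamma> = set \<alpha> \<union> set \<beta>"
  by (induction \<alpha> \<beta> arbitrary: \<gamma> rule: Sh.induct) auto

text \<open>Positions are counted from 1, so \<open>\<alpha>\<^sub>i\<close> is \<open>\<alpha> ! (i - 1)\<close>.\<close>

definition Des :: "word \<Rightarrow> nat set" where
  "Des \<alpha> = {i. 1 \<le> i \<and> i < length \<alpha> \<and> \<alpha> ! (i - 1) > \<alpha> ! i}"

text \<open>A statistic is a function on \<^const>\<open>words\<close>; its values at other lists are irrelevant.\<close>

definition shuffle_compatible :: "(word \<Rightarrow> 'b) \<Rightarrow> bool" where
  "shuffle_compatible st \<longleftrightarrow>
     (\<forall>\<alpha>\<in>words. \<forall>\<beta>\<in>words. \<forall>\<alpha>'\<in>words. \<forall>\<beta>'\<in>words.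
        disjoint_words \<alpha> \<beta> \<and> disjoint_words \<alpha>' \<beta>' \<and>
        length \<alpha> = length \<alpha>' \<and> length \<beta> = length \<beta>' \<and> st \<alpha> = st \<alpha>' \<and> st \<beta> = st \<beta>' \<longrightarrow>
        image_mset st (Sh \<alpha> \<beta>) = image_mset st (Sh \<alpha>' \<beta>')) \<and>
     (\<forall>\<alpha>\<in>words. \<forall>\<beta>\<in>words. pack \<alpha> = pack \<beta> \<longrightarrow> st \<alpha> = st \<beta>)"


section \<open>Algebras over the rationals\<close>

definition rat_ring :: "rat ring" where
  "rat_ring = \<lparr>carrier = UNIV, monoid.mult = (*), one = 1, zero = 0, add = (+)\<rparr>"

definition linear_maps ::
    "('r, 'm) ring_scheme \<Rightarrow> ('r, 'a, 'n) module_scheme \<Rightarrow> ('r, 'b, 'p) module_scheme \<Rightarrow> ('a \<Rightarrow> 'b) set" where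
  "linear_maps R A B = {\<phi> \<in> carrier A \<rightarrow> carrier B.
     (\<forall>x\<in>carrier A. \<forall>y\<in>carrier A. \<phi> (x \<oplus>\<^bsub>A\<^esub> y) = \<phi> x \<oplus>\<^bsub>B\<^esub> \<phi> y) \<and>
     (\<forall>c\<in>carrier R. \<forall>x\<in>carrier A. \<phi> (c \<odot>\<^bsub>A\<^esub> x) = c \<odot>\<^bsub>B\<^esub> \<phi> x)}"

definition algebra_iso ::
    "('r, 'm) ring_scheme \<Rightarrow> ('r, 'a, 'n) module_scheme \<Rightarrow> ('r, 'b, 'p) module_scheme \<Rightarrow> ('a \<Rightarrow> 'b) set" where
  "algebra_iso R A B =
     {\<phi>. algebra R A \<and> algebra R B \<and> \<phi> \<in> linear_maps R A B \<and> \<phi> \<in> ring_iso A B}"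


section \<open>The shuffle algebra of a statistic on words\<close>

definition word_class :: "(word \<Rightarrow> 'b) \<Rightarrow> word \<Rightarrow> word set" where
  "word_class st \<alpha> = {\<beta> \<in> words. st \<beta> = st \<alpha> \<and> length \<beta> = length \<alpha>}"

text \<open>The free vector space on the classes consists of the finitely supported rational-valued
  functions whose support consists of classes; \<open>basis st \<alpha>\<close> is the class of \<open>\<alpha>\<close> as a vector.\<close>

definition basis :: "(word \<Rightarrow> 'b) \<Rightarrow> word \<Rightarrow> (word set \<Rightarrow>\<^sub>0 rat)" where
  "basis st \<alpha> = Poly_Mapping.single (word_class st \<alpha>) 1"

text \<open>The product of two classes, computed from disjoint representatives. For shuffle-compatible
  \<open>st\<close> the result does not depend on them, which makes the description definite: see
  \<open>class_prod_eq\<close> below.\<close>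

definition class_prod :: "(word \<Rightarrow> 'b) \<Rightarrow> word set \<Rightarrow> word set \<Rightarrow> (word set \<Rightarrow>\<^sub>0 rat)" where
  "class_prod st C D =
     (THE p. \<exists>\<alpha>\<in>C. \<exists>\<beta>\<in>D. disjoint_words \<alpha> \<beta> \<and> p = (\<Sum>\<gamma>\<in>#Sh \<alpha> \<beta>. basis st \<gamma>))"

definition scale :: "rat \<Rightarrow> ('a \<Rightarrow>\<^sub>0 rat) \<Rightarrow> ('a \<Rightarrow>\<^sub>0 rat)" where
  "scale c = Poly_Mapping.map ((*) c)"

definition word_algebra :: "(word \<Rightarrow> 'b) \<Rightarrow> (rat, word set \<Rightarrow>\<^sub>0 rat) module" where
  "word_algebra st =
     \<lparr>carrier = {p. Poly_Mapping.keys p \<subseteq> word_class st ` words},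
      monoid.mult = (\<lambda>p q. \<Sum>C\<in>Poly_Mapping.keys p. \<Sum>D\<in>Poly_Mapping.keys q.
                scale (Poly_Mapping.lookup p C * Poly_Mapping.lookup q D) (class_prod st C D)),
      one = basis st [],
      zero = 0,
      add = (+),
      smult = scale\<rparr>"

lemma class_prod_eq:
  assumes st: "shuffle_compatible st"
    and \<alpha>: "\<alpha> \<in> words" and \<beta>: "\<beta> \<in> words" and dis: "disjoint_words \<alpha> \<beta>"
  shows "class_prod st (word_class st \<alpha>) (word_class st \<beta>) = (\<Sum>\<gamma>\<in>#Sh \<alpha> \<beta>. basis st \<gamma>)"
proof -
  have sum_eq: "(\<Sum>\<gamma>\<in>#Sh x y. basis st \<gamma>) =
      (\<Sum>v\<in>#image_mset st (Sh x y).
         Poly_Mapping.single {\<delta> \<in> words. st \<delta> = v \<and> length \<delta> = length x + length y} 1)" for x y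
    unfolding multiset.map_comp comp_def
    by (intro arg_cong[where f = sum_mset] image_mset_cong)
      (simp add: basis_def word_class_def length_Sh)
  have unique: "(\<Sum>\<gamma>\<in>#Sh \<alpha>' \<beta>'. basis st \<gamma>) = (\<Sum>\<gamma>\<in>#Sh \<alpha> \<beta>. basis st \<gamma>)"
    if "\<alpha>' \<in> word_class st \<alpha>" "\<beta>' \<in> word_class st \<beta>" "disjoint_words \<alpha>' \<beta>'" for \<alpha>' \<beta>'
  proof -
    have eqs: "\<alpha>' \<in> words" "\<beta>' \<in> words" "length \<alpha>' = length \<alpha>" "length \<beta>' = length \<beta>"
        "st \<alpha>' = st \<alpha>" "st \<beta>' = st \<beta>"
      using that(1,2) by (simp_all add: word_class_def)
    then have "image_mset st (Sh \<alpha>' \<beta>') = image_mset st (Sh \<alpha> \<beta>)"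
      using conjunct1[OF st[unfolded shuffle_compatible_def]] \<alpha> \<beta> dis that(3) by blast
    then show ?thesis by (simp only: sum_eq eqs)
  qed
  show ?thesis
    unfolding class_prod_def
  proof (rule the_equality)
    show "\<exists>\<alpha>'\<in>word_class st \<alpha>. \<exists>\<beta>'\<in>word_class st \<beta>. disjoint_words \<alpha>' \<beta>' \<and>
        (\<Sum>\<gamma>\<in>#Sh \<alpha> \<beta>. basis st \<gamma>) = (\<Sum>\<gamma>\<in>#Sh \<alpha>' \<beta>'. basis st \<gamma>)"
      using \<alpha> \<beta> dis by (auto simp: word_class_def)
  qed (use unique in blast)
qed

lemma basis_mult:
  assumes "shuffle_compatible st" "\<alpha> \<in> words" "\<beta> \<in> words" "disjoint_words \<alpha> \<beta>"
  shows "basis st \<alpha> \<otimes>\<^bsub>word_algebra st\<^esub> basis st \<beta> = (\<Sum>\<gamma>\<in>#Sh \<alpha> \<beta>. basis st \<gamma>)"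
proof -
  have "scale 1 p = p" for p :: "word set \<Rightarrow>\<^sub>0 rat"
    by (rule poly_mapping_eqI) (simp add: scale_def Poly_Mapping.map.rep_eq when_def)
  then show ?thesis
    using class_prod_eq[OF assms] by (simp add: word_algebra_def basis_def)
qed


section \<open>Quasisymmetric functions\<close>

text \<open>The variables \<open>x\<^sub>1, x\<^sub>2, \<dots>\<close> are indexed from 0: the index \<open>i\<close> stands for
  \<open>x\<^bsub>i+1\<^esub>\<close>. A monomial is given by its exponents, a formal power series by the
  coefficients of the monomials.\<close>

type_synonym monomial = "nat \<Rightarrow>\<^sub>0 nat"
type_synonym power_series = "monomial \<Rightarrow> rat"

definition monomial_of :: "nat list \<Rightarrow> nat list \<Rightarrow> monomial" where
  "monomial_of is as = (\<Sum>(i, a)\<leftarrow>zip is as. Poly_Mapping.single i a)"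

definition total_degree :: "monomial \<Rightarrow> nat" where
  "total_degree m = (\<Sum>i\<in>Poly_Mapping.keys m. Poly_Mapping.lookup m i)"

definition bounded_degree :: "power_series \<Rightarrow> bool" where
  "bounded_degree f \<longleftrightarrow> (\<exists>d. \<forall>m. f m \<noteq> 0 \<longrightarrow> total_degree m \<le> d)"

definition quasisymmetric :: "power_series \<Rightarrow> bool" where
  "quasisymmetric f \<longleftrightarrow>
     (\<forall>is js as. sorted_wrt (<) is \<and> sorted_wrt (<) js \<and> (\<forall>a\<in>set as. 0 < a) \<and>
        length is = length as \<and> length js = length as \<longrightarrow>
        f (monomial_of is as) = f (monomial_of js as))"

definition QSym :: "(rat, power_series) module" where
  "QSym =
     \<lparr>carrier = {f. bounded_degree f \<and> quasisymmetric f},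
      monoid.mult = (\<lambda>f g m. \<Sum>(a, b) | a + b = m. f a * g b),
      one = (\<lambda>m. if m = 0 then 1 else 0),
      zero = (\<lambda>m. 0),
      add = (\<lambda>f g m. f m + g m),
      smult = (\<lambda>c f m. c * f m)\<rparr>"

lemma finite_monomial_factorizations: "finite {(a, b). a + b = (m :: monomial)}"
proof -
  let ?H = "{h. \<forall>i. (i \<in> Poly_Mapping.keys m \<longrightarrow> h i \<in> {..total_degree m}) \<and>
                   (i \<notin> Poly_Mapping.keys m \<longrightarrow> h i = 0)}"
  have fin: "finite ?H"
    by (rule finite_set_of_finite_funs) simp_all
  have le: "Poly_Mapping.lookup m i \<le> total_degree m" if "i \<in> Poly_Mapping.keys m" for i
    unfolding total_degree_def using that by (intro member_le_sum) simp_all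
  have "Poly_Mapping.lookup a \<in> ?H \<and> Poly_Mapping.lookup b \<in> ?H" if "a + b = m" for a b
  proof -
    have "Poly_Mapping.lookup m i = Poly_Mapping.lookup a i + Poly_Mapping.lookup b i" for i
      using that by (simp add: lookup_add[symmetric])
    moreover have "Poly_Mapping.lookup a i \<le> total_degree m \<and> Poly_Mapping.lookup b i \<le> total_degree m"
      if "i \<in> Poly_Mapping.keys m" for i
      using le[OF that] calculation[of i] by linarith
    ultimately show ?thesis by (simp add: in_keys_iff)
  qed
  then have "(\<lambda>(a, b). (Poly_Mapping.lookup a, Poly_Mapping.lookup b)) ` {(a, b). a + b = m} \<subseteq> ?H \<times> ?H"
    by auto
  moreover have "inj_on (\<lambda>(a, b). (Poly_Mapping.lookup a, Poly_Mapping.lookup b)) {(a, b). a + b = m}"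
    by (auto simp: inj_on_def)
  ultimately show ?thesis
    using fin by (meson finite_SigmaI finite_imageD finite_subset)
qed


section \<open>Compositions and the fundamental basis\<close>

definition Comp :: "nat \<Rightarrow> nat set \<Rightarrow> nat list" where
  "Comp n S =
     (if n = 0 then []
      else let s = sorted_list_of_set S in map2 (-) (s @ [n]) (0 # s))"

definition comp_set :: "nat list \<Rightarrow> nat set" where
  "comp_set L = {sum_list (take j L) |j. 0 < j \<and> j < length L}"

text \<open>The coefficient of \<open>m\<close> in the fundamental quasisymmetric function of \<open>L\<close> is the number of
  admissible index sequences with product \<open>m\<close>. The lemma \<open>comp_set_Comp\<close> identifies the
  set of forced strict increases as \<open>S\<close> if \<open>L\<close> is \<open>Comp n S\<close>.\<close>

definition F :: "nat list \<Rightarrow> power_series" where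
  "F L = (\<lambda>m. of_nat (card {is. length is = sum_list L \<and> sorted is \<and>
     (\<forall>j\<in>comp_set L. is ! (j - 1) < is ! j) \<and> (\<Sum>i\<leftarrow>is. Poly_Mapping.single i 1) = m}))"

lemma sum_list_take_differences:
  fixes a :: nat
  assumes "sorted (a # xs)" "j \<le> length xs"
  shows "a + sum_list (take j (map2 (-) xs (a # xs))) = (a # xs) ! j"
  using assms
proof (induction xs arbitrary: a j)
  case (Cons x xs)
  show ?case
  proof (cases j)
    case (Suc k)
    with Cons.IH[of x k] Cons.prems show ?thesis by simp
  qed simp
qed simp

lemma Comp_properties:
  assumes "S \<subseteq> {1..<n}"
  shows sum_list_Comp: "sum_list (Comp n S) = n"
    and comp_set_Comp: "comp_set (Comp n S) = S"
proof -
  define s where "s = sorted_list_of_set S"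
  have "finite S" using assms finite_subset by blast
  then have s: "set s = S" "sorted s" by (simp_all add: s_def)
  show "sum_list (Comp n S) = n" "comp_set (Comp n S) = S"
  proof (atomize(full), cases "n = 0")
    case True
    with assms show "sum_list (Comp n S) = n \<and> comp_set (Comp n S) = S"
      by (simp add: Comp_def comp_set_def)
  next
    case False
    have "zip (s @ [n]) (0 # s) = zip (s @ [n]) ((0 # s) @ [n])"
      by (subst zip_append2) simp
    then have C: "Comp n S = map2 (-) (s @ [n]) (0 # (s @ [n]))"
      using False by (simp add: Comp_def s_def[symmetric])
    have len: "length (Comp n S) = Suc (length s)" by (simp add: C)
    have sorted: "sorted (0 # s @ [n])"
      using s assms by (auto simp: sorted_append)
    have part: "sum_list (take j (Comp n S)) = (0 # s @ [n]) ! j" if "j \<le> Suc (length s)" for j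
      using sum_list_take_differences[OF sorted, of j] that unfolding C by simp
    have "sum_list (Comp n S) = n"
      using part[of "Suc (length s)"] len by simp
    moreover have "comp_set (Comp n S) = (\<lambda>j. sum_list (take j (Comp n S))) ` {0<..<Suc (length s)}"
      unfolding comp_set_def len by (simp add: image_def Bex_def conj_ac)
    moreover have "\<dots> = (\<lambda>j. (0 # s @ [n]) ! j) ` {0<..<Suc (length s)}"
      by (rule image_cong) (simp_all only: part greaterThanLessThan_iff less_imp_le)
    moreover have "\<dots> = (\<lambda>k. s ! k) ` {..<length s}"
    proof -
      have "{0<..<Suc (length s)} = Suc ` {..<length s}"
        by (auto simp: image_iff gr0_conv_Suc)
      then show ?thesis by (simp add: image_image nth_append)
    qed
    moreover have "\<dots> = S" using s(1) by (auto simp: set_conv_nth)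
    ultimately show "sum_list (Comp n S) = n \<and> comp_set (Comp n S) = S" by simp
  qed
qed

end

(* The coefficient of a monomial m in F_Comp(S), for S a subset of {1..n-1}, is 1 if m has degree n
   and S is contained in the set T of proper partial sums of the exponents of m, and 0 otherwise.
   Hence every coefficient of a combination of fundamental functions is a sum over the subsets of
   T, and Moebius inversion on the subset lattice shows that the fundamental functions are a basis
   of QSym. The product of the functions of two disjoint words is the sum over their shuffles; since
   it depends only on the lengths and descent sets, linear independence yields
   shuffle-compatibility, and the same formula makes the map multiplicative. The ring axioms of the
   word algebra are pulled back along this injective map. *)

theory Submission
  imports Defs "HOL-Library.Product_Lexorder"
begin

section \<open>Sums over shuffles\<close>

text \<open>The product formula is the P-partition argument: an admissible index sequence is a
  weakly increasing labelling of a chain, strict at the descents of the word; two disjoint words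
  form a disjoint union of two chains, and the shuffles are its linear extensions. Attaching to each
  letter its index makes this a statement about sorted lists of pairs, where the letter breaks ties
  between equal indices. The value of \<open>class_prod\<close> is under control only once
  shuffle-compatibility is known, so the formula is proved for words, coefficient by coefficient,
  before any algebra appears. The linear map is likewise given by coefficients, without choosing
  representatives. Associativity inside the word algebra would call for triples of pairwise disjoint
  representatives; comparison with power series avoids them.\<close>

lemma Sh_Nil2 [simp]: "Sh \<alpha> [] = {#\<alpha>#}"
  by (cases \<alpha>) simp_all

lemma mset_Sh: "\<gamma> \<in># Sh \<alpha> \<beta> \<Longrightarrow> mset \<gamma> = mset \<alpha> + mset \<beta>"
  by (induction \<alpha> \<beta> arbitrary: \<gamma> rule: Sh.induct) auto

lemma words_Sh: "\<alpha> \<in> words \<Longrightarrow> \<beta> \<in> words \<Longrightarrow> \<gamma> \<in># Sh \<alpha> \<beta> \<Longrightarrow> \<gamma> \<in> words"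
  by (auto simp: words_def dest: set_Sh)

lemma sum_mset_sorted_Cons:
  assumes "\<And>r. r \<in># M \<Longrightarrow> set r = A"
  shows "(\<Sum>r\<in>#M. of_bool (sorted (p # r))) =
    (of_bool (\<forall>x\<in>A. p \<le> x) * (\<Sum>r\<in>#M. of_bool (sorted r)) :: 'b::semiring_1)"
  using assms by (induction M) (auto simp: of_bool_def)

text \<open>Merging is forced: the smaller head has to come first, so only one of the two recursive
  summands survives.\<close>

lemma sum_mset_sorted_Sh:
  fixes xs ys :: "'a::linorder list"
  assumes "set xs \<inter> set ys = {}"
  shows "(\<Sum>r\<in>#Sh xs ys. of_bool (sorted r)) = (of_bool (sorted xs \<and> sorted ys) :: 'b::semiring_1)"
  using assms
proof (induction xs ys rule: Sh.induct)
  case (3 p ps q qs)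
  have "(\<Sum>r\<in>#Sh (p # ps) (q # qs). of_bool (sorted r)) =
      (\<Sum>r\<in>#Sh ps (q # qs). of_bool (sorted (p # r))) +
      (\<Sum>r\<in>#Sh (p # ps) qs. of_bool (sorted (q # r)) :: 'b::semiring_1)"
    by (simp add: multiset.map_comp comp_def del: sorted_simps)
  also have "\<dots> = of_bool (\<forall>x\<in>set ps \<union> set (q # qs). p \<le> x) * of_bool (sorted ps \<and> sorted (q # qs)) +
      of_bool (\<forall>x\<in>set (p # ps) \<union> set qs. q \<le> x) * of_bool (sorted (p # ps) \<and> sorted qs)"
  proof -
    have "(\<Sum>r\<in>#Sh ps (q # qs). of_bool (sorted r)) = (of_bool (sorted ps \<and> sorted (q # qs)) :: 'b::semiring_1)"
      "(\<Sum>r\<in>#Sh (p # ps) qs. of_bool (sorted r)) = (of_bool (sorted (p # ps) \<and> sorted qs) :: 'b::semiring_1)"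
      by (rule 3(1), use 3(3) in force) (rule 3(2), use 3(3) in force)
    then show ?thesis
      by (simp only: sum_mset_sorted_Cons[OF set_Sh])
  qed
  also have "\<dots> = of_bool (sorted (p # ps) \<and> sorted (q # qs))"
  proof -
    \<comment> \<open>A tie between the heads could let both summands survive; disjointness excludes
      it.\<close>
    have "p \<noteq> q"
      using 3(3) by auto
    then consider "p < q" | "q < p"
      by (rule linorder_neqE)
    then show ?thesis
    proof cases
      case 1
      then have "\<not> (\<forall>x\<in>set (p # ps) \<union> set qs. q \<le> x)"
        by auto
      moreover have "(\<forall>x\<in>set ps \<union> set (q # qs). p \<le> x) \<and> sorted ps \<and> sorted (q # qs) \<longleftrightarrow>
          sorted (p # ps) \<and> sorted (q # qs)"
        using 1 by auto
      ultimately show ?thesis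
        by (simp only: of_bool_conj[symmetric] simp_thms of_bool_eq mult_zero_left add_0_left add_0_right)
    next
      case 2
      then have "\<not> (\<forall>x\<in>set ps \<union> set (q # qs). p \<le> x)"
        by auto
      moreover have "(\<forall>x\<in>set (p # ps) \<union> set qs. q \<le> x) \<and> sorted (p # ps) \<and> sorted qs \<longleftrightarrow>
          sorted (p # ps) \<and> sorted (q # qs)"
        using 2 by auto
      ultimately show ?thesis
        by (simp only: of_bool_conj[symmetric] simp_thms of_bool_eq mult_zero_left add_0_left add_0_right)
    qed
  qed
  finally show ?case .
qed simp_all

text \<open>Indices are confined to a finite set so that sums over index sequences are finite;
  \<open>K\<close> will be the support of a monomial.\<close>

definition lists_of :: "'a set \<Rightarrow> nat \<Rightarrow> 'a list set" where
  "lists_of K n = {xs. set xs \<subseteq> K \<and> length xs = n}"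

lemma finite_lists_of: "finite K \<Longrightarrow> finite (lists_of K n)"
  unfolding lists_of_def by (rule finite_lists_length_eq)

lemma sum_lists_of_0: "(\<Sum>xs\<in>lists_of K 0. g xs) = g []"
proof -
  have "lists_of K 0 = {[]}"
    by (auto simp: lists_of_def)
  then show ?thesis by simp
qed

lemma sum_lists_of_Suc:
  "(\<Sum>xs\<in>lists_of K (Suc n). g xs) = (\<Sum>k\<in>K. \<Sum>xs\<in>lists_of K n. g (k # xs))"
proof -
  have "lists_of K (Suc n) = (\<lambda>(k, xs). k # xs) ` (K \<times> lists_of K n)"
    by (auto simp: lists_of_def length_Suc_conv image_iff)
  moreover have "inj_on (\<lambda>(k, xs). k # xs) (K \<times> lists_of K n)"
    by (auto simp: inj_on_def)
  ultimately show ?thesis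
    by (simp add: sum.reindex sum.cartesian_product case_prod_unfold)
qed

lemma sum_sum_mset_swap: "(\<Sum>x\<in>#M. \<Sum>k\<in>K. g x k) = (\<Sum>k\<in>K. \<Sum>x\<in>#M. g x k)"
  by (induction M) (simp_all add: sum.distrib)

lemma sum_zip_Cons:
  "(\<Sum>\<gamma>\<in>#M. \<Sum>ks\<in>lists_of K (Suc n). f (zip ks (c # \<gamma>))) =
    (\<Sum>k\<in>K. \<Sum>\<gamma>\<in>#M. \<Sum>ks\<in>lists_of K n. f ((k, c) # zip ks \<gamma>))"
  by (simp add: sum_lists_of_Suc sum_sum_mset_swap)

text \<open>Each letter carries its index along: shuffling the words and then indexing the result
  gives the same lists of pairs as indexing both words and then shuffling.\<close>

lemma sum_Sh_zip:
  fixes f :: "('i \<times> 'a) list \<Rightarrow> 'b::comm_monoid_add"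
  shows "(\<Sum>\<gamma>\<in>#Sh \<alpha> \<beta>. \<Sum>ks\<in>lists_of K (length \<alpha> + length \<beta>). f (zip ks \<gamma>)) =
    (\<Sum>is\<in>lists_of K (length \<alpha>). \<Sum>js\<in>lists_of K (length \<beta>). \<Sum>r\<in>#Sh (zip is \<alpha>) (zip js \<beta>). f r)"
proof (induction \<alpha> \<beta> arbitrary: f rule: Sh.induct)
  case (3 a \<alpha> b \<beta>)
  let ?n = "length \<alpha>" and ?m = "length \<beta>"
  have "(\<Sum>\<gamma>\<in>#Sh (a # \<alpha>) (b # \<beta>). \<Sum>ks\<in>lists_of K (length (a # \<alpha>) + length (b # \<beta>)). f (zip ks \<gamma>)) =
    (\<Sum>k\<in>K. \<Sum>\<gamma>\<in>#Sh \<alpha> (b # \<beta>). \<Sum>ks\<in>lists_of K (length \<alpha> + length (b # \<beta>)). f ((k, a) # zip ks \<gamma>)) +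
    (\<Sum>k\<in>K. \<Sum>\<gamma>\<in>#Sh (a # \<alpha>) \<beta>. \<Sum>ks\<in>lists_of K (length (a # \<alpha>) + length \<beta>). f ((k, b) # zip ks \<gamma>))"
    by (simp add: multiset.map_comp comp_def sum_zip_Cons)
  also have "\<dots> =
    (\<Sum>k\<in>K. \<Sum>is\<in>lists_of K ?n. \<Sum>js\<in>lists_of K (length (b # \<beta>)).
       \<Sum>r\<in>#Sh (zip is \<alpha>) (zip js (b # \<beta>)). f ((k, a) # r)) +
    (\<Sum>k\<in>K. \<Sum>is\<in>lists_of K (length (a # \<alpha>)). \<Sum>js\<in>lists_of K ?m.
       \<Sum>r\<in>#Sh (zip is (a # \<alpha>)) (zip js \<beta>). f ((k, b) # r))"
    by (simp only: 3[of "\<lambda>r. f (_ # r)"])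
  also have "\<dots> = (\<Sum>i\<in>K. \<Sum>is\<in>lists_of K ?n. \<Sum>j\<in>K. \<Sum>js\<in>lists_of K ?m.
       (\<Sum>r\<in>#Sh (zip is \<alpha>) ((j, b) # zip js \<beta>). f ((i, a) # r)) +
       (\<Sum>r\<in>#Sh ((i, a) # zip is \<alpha>) (zip js \<beta>). f ((j, b) # r)))"
  proof -
    \<comment> \<open>When the shuffle starts with \<open>b\<close>, the index \<open>k\<close> is
      the head of the second list; it is moved inside so that both sums run over the first list
      first.\<close>
    have "(\<Sum>k\<in>K. \<Sum>is\<in>lists_of K (length (a # \<alpha>)). \<Sum>js\<in>lists_of K ?m.
         \<Sum>r\<in>#Sh (zip is (a # \<alpha>)) (zip js \<beta>). f ((k, b) # r)) =
       (\<Sum>is\<in>lists_of K (length (a # \<alpha>)). \<Sum>k\<in>K. \<Sum>js\<in>lists_of K ?m.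
         \<Sum>r\<in>#Sh (zip is (a # \<alpha>)) (zip js \<beta>). f ((k, b) # r))"
      by (rule sum.swap)
    then show ?thesis
      by (simp add: sum_lists_of_Suc sum.distrib)
  qed
  finally show ?case
    by (simp add: sum_lists_of_Suc multiset.map_comp comp_def)
qed (simp_all add: sum_lists_of_0)


section \<open>Exponents and coefficients of fundamental functions\<close>

lemma lookup_index_product:
  "Poly_Mapping.lookup (\<Sum>i\<leftarrow>is. Poly_Mapping.single i 1) k = count (mset is) k"
  by (induction "is") (simp_all add: lookup_add lookup_single)

text \<open>The only sorted index sequence with product \<open>m\<close>.\<close>

definition index_list :: "monomial \<Rightarrow> nat list" where
  "index_list m = concat (map (\<lambda>i. replicate (Poly_Mapping.lookup m i) i)
     (sorted_list_of_set (Poly_Mapping.keys m)))"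

text \<open>The composition of the monomial quasisymmetric function in which \<open>m\<close>
  occurs.\<close>

definition exponents :: "monomial \<Rightarrow> nat list" where
  "exponents m = map (Poly_Mapping.lookup m) (sorted_list_of_set (Poly_Mapping.keys m))"

lemma exponents_pos: "a \<in> set (exponents m) \<Longrightarrow> 0 < a"
  by (auto simp: exponents_def in_keys_iff)

lemma sum_list_exponents: "sum_list (exponents m) = total_degree m"
  by (simp add: exponents_def total_degree_def sum_list_distinct_conv_sum_set)

lemma count_concat_replicate:
  "distinct ks \<Longrightarrow> count (mset (concat (map (\<lambda>i. replicate (g i) i) ks))) k = (if k \<in> set ks then g k else 0)"
  by (induction ks) auto

lemma count_index_list: "count (mset (index_list m)) k = Poly_Mapping.lookup m k"
  by (simp add: index_list_def count_concat_replicate in_keys_iff)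

lemma sorted_concat_replicate:
  "sorted ks \<Longrightarrow> sorted (concat (map (\<lambda>i. replicate (g i) i) ks))"
  by (induction ks) (auto simp: sorted_append)

text \<open>A sorted list is determined by its multiset of entries.\<close>

lemma index_product_eq_iff:
  "sorted is \<and> (\<Sum>i\<leftarrow>is. Poly_Mapping.single i 1) = m \<longleftrightarrow> is = index_list m"
proof -
  have "sorted (index_list m)"
    by (simp add: index_list_def sorted_concat_replicate)
  moreover have "(\<Sum>i\<leftarrow>is. Poly_Mapping.single i 1) = m \<longleftrightarrow> mset is = mset (index_list m)"
    by (simp add: poly_mapping_eq_iff fun_eq_iff lookup_index_product multiset_eq_iff count_index_list
        del: One_nat_def)
  ultimately show ?thesis
    by (metis properties_for_sort)
qed

lemma length_index_list: "length (index_list m) = total_degree m"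
  by (simp add: index_list_def length_concat comp_def exponents_def[symmetric] sum_list_exponents)

definition ascents :: "nat list \<Rightarrow> nat set" where
  "ascents xs = {j. 0 < j \<and> j < length xs \<and> xs ! (j - 1) < xs ! j}"

text \<open>A block is constant and everything after it is larger, so its end gives the one new
  ascent. \<open>comp_set_Cons\<close> is the same recursion.\<close>

lemma ascents_replicate_append:
  assumes "0 < a" "\<forall>y\<in>set ys. i < y"
  shows "ascents (replicate a i @ ys) = (if ys = [] then {} else insert a ((+) a ` ascents ys))"
proof -
  have "j \<in> ascents (replicate a i @ ys) \<longleftrightarrow>
      j \<in> (if ys = [] then {} else insert a ((+) a ` ascents ys))" for j
  proof (cases j a rule: linorder_cases)
    case greater
    then obtain k where "j = a + k" "0 < k"
      using less_imp_add_positive by blast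
    then show ?thesis
      using assms by (auto simp: ascents_def nth_append image_iff)
  qed (use assms in \<open>auto simp: ascents_def nth_append\<close>)
  then show ?thesis
    by blast
qed

lemma comp_set_Cons:
  "comp_set (a # as) = (if as = [] then {} else insert a ((+) a ` comp_set as))"
proof -
  have "comp_set (a # as) = (\<lambda>j. sum_list (take j (a # as))) ` Suc ` {..<length as}"
    unfolding comp_set_def by (auto simp: image_iff gr0_conv_Suc Bex_def)
  also have "\<dots> = (\<lambda>k. a + sum_list (take k as)) ` {..<length as}"
    by (simp add: image_image)
  also have "{..<length as} = (if as = [] then {} else insert 0 {0<..<length as})"
    by auto
  also have "(\<lambda>k. a + sum_list (take k as)) ` \<dots> = (if as = [] then {} else insert a ((+) a ` comp_set as))"
    unfolding comp_set_def by (auto simp: image_iff)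
  finally show ?thesis .
qed

lemma comp_set_Nil [simp]: "comp_set [] = {}"
  by (simp add: comp_set_def)

lemma ascents_concat_replicate:
  assumes "sorted_wrt (<) ks" "\<forall>k\<in>set ks. 0 < g k"
  shows "ascents (concat (map (\<lambda>i. replicate (g i) i) ks)) = comp_set (map g ks)"
  using assms
proof (induction ks)
  case (Cons k ks)
  have "concat (map (\<lambda>i. replicate (g i) i) ks) = [] \<longleftrightarrow> ks = []"
    using Cons.prems(2) by auto
  then show ?case
    using Cons by (simp add: ascents_replicate_append comp_set_Cons)
qed (simp add: ascents_def)

lemma ascents_index_list: "ascents (index_list m) = comp_set (exponents m)"
  unfolding index_list_def exponents_def
  by (rule ascents_concat_replicate) (auto simp: in_keys_iff)

text \<open>Only \<open>index_list m\<close> can be counted, so the cardinality is 0 or 1, and the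
  increases forced by \<open>S\<close> must be among its ascents.\<close>

lemma F_Comp:
  assumes "S \<subseteq> {1..<n}"
  shows "F (Comp n S) m = of_bool (total_degree m = n \<and> S \<subseteq> comp_set (exponents m))"
proof -
  have "{is. length is = n \<and> sorted is \<and> (\<forall>j\<in>S. is ! (j - 1) < is ! j) \<and>
      (\<Sum>i\<leftarrow>is. Poly_Mapping.single i 1) = m} =
    {is. (sorted is \<and> (\<Sum>i\<leftarrow>is. Poly_Mapping.single i 1) = m) \<and>
      length is = n \<and> (\<forall>j\<in>S. is ! (j - 1) < is ! j)}"
    by blast
  also have "\<dots> = {is. is = index_list m \<and> total_degree m = n \<and> (\<forall>j\<in>S. is ! (j - 1) < is ! j)}"
    unfolding index_product_eq_iff by (auto simp: length_index_list)
  also have "\<dots> = {is. is = index_list m \<and> total_degree m = n \<and> S \<subseteq> ascents (index_list m)}"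
    using assms by (auto simp: ascents_def length_index_list)
  finally show ?thesis
    using assms by (simp add: F_def sum_list_Comp comp_set_Comp ascents_index_list)
qed

section \<open>Compositions and their sets of partial sums\<close>

lemma comp_set_subset: "\<forall>a\<in>set as. 0 < a \<Longrightarrow> comp_set as \<subseteq> {1..<sum_list as}"
  by (induction as) (auto simp: comp_set_Cons neq_Nil_conv Suc_le_eq)

text \<open>The first part is the least partial sum; once it is removed, the tails again have equal
  partial sums.\<close>

lemma composition_eqI:
  assumes "\<forall>a\<in>set as. 0 < a" "\<forall>b\<in>set bs. 0 < b"
    and "sum_list as = sum_list bs" "comp_set as = comp_set bs"
  shows "as = bs"
  using assms
proof (induction as arbitrary: bs)
  case Nil
  then show ?case
    by (cases bs) auto
next
  case (Cons a as)
  then obtain b bs' where bs: "bs = b # bs'"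
    by (cases bs) auto
  show ?case
  proof (cases "as = [] \<or> bs' = []")
    case True
    then show ?thesis
      using Cons.prems(3,4) by (auto simp: bs comp_set_Cons split: if_splits)
  next
    case False
    then have eq: "insert a ((+) a ` comp_set as) = insert b ((+) b ` comp_set bs')"
      using Cons.prems(4) by (simp add: bs comp_set_Cons)
    then have "a \<in> insert b ((+) b ` comp_set bs')" "b \<in> insert a ((+) a ` comp_set as)"
      by blast+
    \<comment> \<open>Each first part equals the other or the other plus something, hence is at
      least as large.\<close>
    then have "a = b"
      by auto
    \<comment> \<open>Ensures that \<open>a\<close> does not recur among the shifted sums, so the
      inserted element can be cancelled.\<close>
    moreover have "0 \<notin> comp_set as" "0 \<notin> comp_set bs'"
      using comp_set_subset[of as] comp_set_subset[of bs'] Cons.prems(1,2) by (auto simp: bs)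
    then have "a \<notin> (+) a ` comp_set as" "a \<notin> (+) a ` comp_set bs'"
      by auto
    ultimately have "(+) a ` comp_set as = (+) a ` comp_set bs'"
      using eq by (metis insert_ident)
    then have "comp_set as = comp_set bs'"
      by (simp add: inj_image_eq_iff)
    then show ?thesis
      using Cons.IH[of bs'] Cons.prems \<open>a = b\<close> by (simp add: bs)
  qed
qed

lemma differences_pos:
  "sorted_wrt (<) (a # xs) \<Longrightarrow> \<forall>d\<in>set (map2 (-) xs (a # xs)). 0 < (d :: nat)"
proof (induction xs arbitrary: a)
  case (Cons x xs)
  then have "\<forall>d\<in>set (map2 (-) xs (x # xs)). 0 < d"
    by (intro Cons.IH) simp
  then show ?case
    using Cons.prems by simp
qed simp

lemma Comp_pos:
  assumes "S \<subseteq> {1..<n}"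
  shows "\<forall>a\<in>set (Comp n S). 0 < a"
proof (cases "n = 0")
  case False
  define s where "s = sorted_list_of_set S"
  have "finite S"
    using assms finite_subset by blast
  then have s: "set s = S" "sorted_wrt (<) s"
    by (simp_all add: s_def)
  have "zip (s @ [n]) (0 # s) = zip (s @ [n]) ((0 # s) @ [n])"
    by (subst zip_append2) simp
  then have "Comp n S = map2 (-) (s @ [n]) (0 # (s @ [n]))"
    using False by (simp add: Comp_def s_def Let_def)
  moreover have "sorted_wrt (<) (0 # s @ [n])"
    using s assms False by (auto simp: sorted_wrt_append)
  ultimately show ?thesis
    using differences_pos by metis
qed (simp add: Comp_def)

section \<open>Quasisymmetry through exponent sequences\<close>

lemma lookup_monomial_of_map:
  "distinct ks \<Longrightarrow> Poly_Mapping.lookup (monomial_of ks (map g ks)) k = (if k \<in> set ks then g k else 0)"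
  by (induction ks) (auto simp: monomial_of_def lookup_add lookup_single when_def)

lemma ex_map_eq: "distinct is \<Longrightarrow> length is = length as \<Longrightarrow> \<exists>g. as = map g is"
proof (induction "is" arbitrary: as)
  case (Cons i "is")
  then obtain a as' where as: "as = a # as'"
    by (cases as) auto
  then obtain g where "as' = map g is"
    using Cons by auto
  then have "as = map (g(i := a)) (i # is)"
    using Cons.prems as by simp
  then show ?case by blast
qed simp

lemma exponents_monomial_of:
  assumes "sorted_wrt (<) is" "length is = length as" "\<forall>a\<in>set as. 0 < a"
  shows "exponents (monomial_of is as) = as"
proof -
  have "distinct is"
    using assms(1) strict_sorted_iff by blast
  then obtain g where g: "as = map g is"
    using ex_map_eq assms(2) by blast
  have "Poly_Mapping.keys (monomial_of is as) = set is"
    using assms(3) \<open>distinct is\<close> by (auto simp: g in_keys_iff lookup_monomial_of_map split: if_splits)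
  moreover have "sorted_list_of_set (set is) = is"
    using assms(1) by (simp add: sorted_list_of_set.idem_if_sorted_distinct strict_sorted_iff)
  ultimately show ?thesis
    using \<open>distinct is\<close> by (simp add: exponents_def g lookup_monomial_of_map)
qed

lemma monomial_of_exponents:
  "monomial_of (sorted_list_of_set (Poly_Mapping.keys m)) (exponents m) = m"
  by (rule poly_mapping_eqI) (simp add: exponents_def lookup_monomial_of_map in_keys_iff)

text \<open>A monomial is rebuilt from its support and its exponents, so \<open>exponents\<close> is
  a complete invariant of order-preserving changes of variables.\<close>

lemma quasisymmetric_iff:
  "quasisymmetric f \<longleftrightarrow> (\<forall>m m'. exponents m = exponents m' \<longrightarrow> f m = f m')"
proof
  assume f: "quasisymmetric f"
  show "\<forall>m m'. exponents m = exponents m' \<longrightarrow> f m = f m'"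
  proof (intro allI impI)
    fix m m' assume eq: "exponents m = exponents m'"
    let ?l = "\<lambda>m. sorted_list_of_set (Poly_Mapping.keys (m :: monomial))"
    have "length (?l m) = length (exponents m)" "length (?l m') = length (exponents m)"
      using arg_cong[OF eq, of length] by (simp_all add: exponents_def)
    then have "f (monomial_of (?l m) (exponents m)) = f (monomial_of (?l m') (exponents m))"
      using f exponents_pos unfolding quasisymmetric_def by simp
    then show "f m = f m'"
      by (metis eq monomial_of_exponents)
  qed
qed (simp add: quasisymmetric_def exponents_monomial_of)

text \<open>The first variables with exponents \<open>Comp n T\<close> do. Such monomials make every
  subset \<open>T\<close> available for inversion.\<close>

lemma ex_monomial:
  assumes "T \<subseteq> {1..<n}"
  obtains m where "total_degree m = n" "comp_set (exponents m) = T"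
proof -
  have "exponents (monomial_of [0..<length (Comp n T)] (Comp n T)) = Comp n T"
    using Comp_pos[OF assms] by (intro exponents_monomial_of) auto
  then show ?thesis
    using that sum_list_exponents by (metis sum_list_Comp comp_set_Comp assms)
qed

lemma comp_set_exponents: "comp_set (exponents m) \<subseteq> {1..<total_degree m}"
  using comp_set_subset[of "exponents m"] exponents_pos by (simp add: sum_list_exponents)

lemma quasisymmetric_eqI:
  assumes "quasisymmetric f" "total_degree m = total_degree m'"
    and "comp_set (exponents m) = comp_set (exponents m')"
  shows "f m = f m'"
proof -
  have "exponents m = exponents m'"
    by (rule composition_eqI) (simp_all add: exponents_pos sum_list_exponents assms)
  then show ?thesis
    using assms(1) quasisymmetric_iff by blast
qed

lemma total_degree_eq: "exponents m = exponents m' \<Longrightarrow> total_degree m = total_degree m'"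
  by (metis sum_list_exponents)


section \<open>The product formula and shuffle-compatibility\<close>

lemma Des_subset: "Des \<alpha> \<subseteq> {1..<length \<alpha>}"
  by (auto simp: Des_def)

lemma F_Des:
  "F (Comp (length \<alpha>) (Des \<alpha>)) m = of_bool (total_degree m = length \<alpha> \<and> Des \<alpha> \<subseteq> comp_set (exponents m))"
  by (rule F_Comp[OF Des_subset])

text \<open>Where \<open>is\<close> rises the letters are irrelevant; where it stays constant the
  lexicographic order forbids a descent.\<close>

lemma sorted_zip_iff:
  assumes "length is = length \<alpha>"
  shows "sorted (zip is \<alpha>) \<longleftrightarrow> sorted is \<and> (\<forall>j\<in>Des \<alpha>. is ! (j - 1) < is ! j)"
proof -
  have "(\<forall>j\<in>Des \<alpha>. is ! (j - 1) < is ! j) \<longleftrightarrow>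
      (\<forall>i. Suc i < length \<alpha> \<longrightarrow> \<alpha> ! Suc i < \<alpha> ! i \<longrightarrow> is ! i < is ! Suc i)"
    by (auto simp: Des_def gr0_conv_Suc Suc_le_eq)
  then show ?thesis
    using assms by (simp add: sorted_iff_nth_Suc) (meson le_less linorder_not_le)
qed

text \<open>A sequence with product \<open>m\<close> uses exactly the support of \<open>m\<close>. A
  larger \<open>K\<close> is allowed so that both factors of a monomial can be expanded over the
  same set of indices.\<close>

lemma F_word:
  assumes "finite K" "Poly_Mapping.keys m \<subseteq> K"
  shows "F (Comp (length \<alpha>) (Des \<alpha>)) m = (\<Sum>is\<in>lists_of K (length \<alpha>).
    of_bool (sorted (zip is \<alpha>) \<and> (\<Sum>i\<leftarrow>is. Poly_Mapping.single i 1) = m))"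
proof -
  have keys: "set is = Poly_Mapping.keys m" if "(\<Sum>i\<leftarrow>is. Poly_Mapping.single i 1) = m" for "is"
    unfolding that[symmetric] by (auto simp: in_keys_iff lookup_index_product simp del: One_nat_def)
  have "{is. length is = length \<alpha> \<and> sorted is \<and> (\<forall>j\<in>Des \<alpha>. is ! (j - 1) < is ! j) \<and>
        (\<Sum>i\<leftarrow>is. Poly_Mapping.single i 1) = m} =
      lists_of K (length \<alpha>) \<inter> {is. sorted (zip is \<alpha>) \<and> (\<Sum>i\<leftarrow>is. Poly_Mapping.single i 1) = m}"
    using assms(2) keys unfolding lists_of_def by (auto simp: sorted_zip_iff)
  then show ?thesis
    using assms(1) Des_subset[of \<alpha>]
    by (simp add: F_def sum_list_Comp comp_set_Comp sum_of_bool_eq finite_lists_of)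
qed

lemma sum_list_Sh_zip:
  fixes w :: "'i \<Rightarrow> 'b::comm_monoid_add"
  assumes "r \<in># Sh (zip is \<alpha>) (zip js \<beta>)" "length is = length \<alpha>" "length js = length \<beta>"
  shows "(\<Sum>i\<leftarrow>map fst r. w i) = (\<Sum>i\<leftarrow>is. w i) + (\<Sum>i\<leftarrow>js. w i)"
proof -
  have "mset (map fst r) = mset (map fst (zip is \<alpha>)) + mset (map fst (zip js \<beta>))"
    using mset_Sh[OF assms(1)] by (simp only: mset_map image_mset_union)
  then have "mset (map fst r) = mset (is @ js)"
    using assms(2,3) by simp
  then have "sum_mset (image_mset w (mset (map fst r))) = sum_mset (image_mset w (mset (is @ js)))"
    by (rule arg_cong)
  then show ?thesis
    by (simp only: mset_map[symmetric] sum_mset_sum_list map_append sum_list.append)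
qed

text \<open>Only the factorization \<open>(u, v)\<close> can contribute. This turns a condition on
  \<open>u + v\<close> into a convolution.\<close>

lemma sum_factorizations_delta:
  "(\<Sum>(a, b) | a + b = (m :: monomial). of_bool (P \<and> u = a) * of_bool (Q \<and> v = b)) =
     (of_bool (u + v = m) * of_bool (P \<and> Q) :: rat)"
proof -
  have "(\<Sum>(a, b) | a + b = m. of_bool (P \<and> u = a) * of_bool (Q \<and> v = b)) =
      (\<Sum>x | fst x + snd x = m. if x = (u, v) then of_bool (P \<and> Q) else (0::rat))"
    by (rule sum.cong) auto
  then show ?thesis
    using finite_monomial_factorizations[of m] by (simp add: case_prod_unfold)
qed

text \<open>An index sequence is admissible for \<open>\<alpha>\<close> iff its zip with \<open>\<alpha>\<close> is
  lexicographically sorted, and two sorted lists without common elements have exactly one sorted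
  shuffle.\<close>

theorem sum_F_Sh:
  assumes "disjoint_words \<alpha> \<beta>"
  shows "(\<Sum>\<gamma>\<in>#Sh \<alpha> \<beta>. F (Comp (length \<gamma>) (Des \<gamma>)) m) =
    (\<Sum>(a, b) | a + b = m. F (Comp (length \<alpha>) (Des \<alpha>)) a * F (Comp (length \<beta>) (Des \<beta>)) b)"
proof -
  define K where "K = Poly_Mapping.keys m"
  define w :: "nat list \<Rightarrow> monomial" where "w = (\<lambda>is. \<Sum>i\<leftarrow>is. Poly_Mapping.single i 1)"
  have K: "finite K" "Poly_Mapping.keys m \<subseteq> K"
    by (simp_all add: K_def)
  have "(\<Sum>\<gamma>\<in>#Sh \<alpha> \<beta>. F (Comp (length \<gamma>) (Des \<gamma>)) m) =
      (\<Sum>\<gamma>\<in>#Sh \<alpha> \<beta>. \<Sum>ks\<in>lists_of K (length \<alpha> + length \<beta>).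
         of_bool (sorted (zip ks \<gamma>) \<and> w (map fst (zip ks \<gamma>)) = m))"
  proof (intro arg_cong[where f = sum_mset] image_mset_cong)
    fix \<gamma> assume "\<gamma> \<in># Sh \<alpha> \<beta>"
    then show "F (Comp (length \<gamma>) (Des \<gamma>)) m = (\<Sum>ks\<in>lists_of K (length \<alpha> + length \<beta>).
         of_bool (sorted (zip ks \<gamma>) \<and> w (map fst (zip ks \<gamma>)) = m))"
      unfolding F_word[OF K] by (intro sum.cong) (simp_all add: length_Sh lists_of_def w_def)
  qed
  also have "\<dots> = (\<Sum>is\<in>lists_of K (length \<alpha>). \<Sum>js\<in>lists_of K (length \<beta>).
      \<Sum>r\<in>#Sh (zip is \<alpha>) (zip js \<beta>). of_bool (sorted r \<and> w (map fst r) = m))"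
    by (rule sum_Sh_zip)
  also have "\<dots> = (\<Sum>is\<in>lists_of K (length \<alpha>). \<Sum>js\<in>lists_of K (length \<beta>).
      of_bool (w is + w js = m) * of_bool (sorted (zip is \<alpha>) \<and> sorted (zip js \<beta>)))"
  proof (intro sum.cong refl)
    fix "is" js assume "is \<in> lists_of K (length \<alpha>)" "js \<in> lists_of K (length \<beta>)"
    then have len: "length is = length \<alpha>" "length js = length \<beta>"
      by (simp_all add: lists_of_def)
    \<comment> \<open>The letters alone separate the pairs, even when \<open>is\<close> and
      \<open>js\<close> share indices.\<close>
    have "set (zip is \<alpha>) \<inter> set (zip js \<beta>) = {}"
      using assms by (auto simp: disjoint_words_def dest: set_zip_rightD)
    then have "(\<Sum>r\<in>#Sh (zip is \<alpha>) (zip js \<beta>). of_bool (sorted r)) =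
        (of_bool (sorted (zip is \<alpha>) \<and> sorted (zip js \<beta>)) :: rat)"
      by (rule sum_mset_sorted_Sh)
    moreover have "(\<Sum>r\<in>#Sh (zip is \<alpha>) (zip js \<beta>). of_bool (sorted r \<and> w (map fst r) = m)) =
        (\<Sum>r\<in>#Sh (zip is \<alpha>) (zip js \<beta>). of_bool (w is + w js = m) * of_bool (sorted r) :: rat)"
      by (intro arg_cong[where f = sum_mset] image_mset_cong)
        (simp only: w_def sum_list_Sh_zip[OF _ len] of_bool_conj mult.commute)
    ultimately show "(\<Sum>r\<in>#Sh (zip is \<alpha>) (zip js \<beta>). of_bool (sorted r \<and> w (map fst r) = m)) =
        (of_bool (w is + w js = m) * of_bool (sorted (zip is \<alpha>) \<and> sorted (zip js \<beta>)) :: rat)"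
      by (simp only: sum_mset_distrib_left[symmetric])
  qed
  also have "\<dots> = (\<Sum>is\<in>lists_of K (length \<alpha>). \<Sum>js\<in>lists_of K (length \<beta>). \<Sum>(a, b) | a + b = m.
      of_bool (sorted (zip is \<alpha>) \<and> w is = a) * of_bool (sorted (zip js \<beta>) \<and> w js = b))"
    by (simp only: sum_factorizations_delta)
  also have "\<dots> = (\<Sum>(a, b) | a + b = m. \<Sum>is\<in>lists_of K (length \<alpha>). \<Sum>js\<in>lists_of K (length \<beta>).
      of_bool (sorted (zip is \<alpha>) \<and> w is = a) * of_bool (sorted (zip js \<beta>) \<and> w js = b))"
    unfolding case_prod_unfold by (subst sum.swap, rule sum.cong[OF refl], rule sum.swap)
  also have "\<dots> = (\<Sum>(a, b) | a + b = m.
      F (Comp (length \<alpha>) (Des \<alpha>)) a * F (Comp (length \<beta>) (Des \<beta>)) b)"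
  proof (intro sum.cong refl, clarify)
    fix a b assume "m = a + b"
    \<comment> \<open>Exponents are natural numbers, so nothing cancels in
      \<open>a + b\<close>.\<close>
    then have "Poly_Mapping.keys a \<subseteq> K" "Poly_Mapping.keys b \<subseteq> K"
      by (auto simp: K_def in_keys_iff lookup_add)
    then show "(\<Sum>is\<in>lists_of K (length \<alpha>). \<Sum>js\<in>lists_of K (length \<beta>).
        of_bool (sorted (zip is \<alpha>) \<and> w is = a) * of_bool (sorted (zip js \<beta>) \<and> w js = b)) =
      F (Comp (length \<alpha>) (Des \<alpha>)) a * F (Comp (length \<beta>) (Des \<beta>)) b"
      by (simp only: F_word[OF K(1)] sum_product w_def)
  qed
  finally show ?thesis .
qed

text \<open>Uniqueness in Moebius inversion, for cancellative monoids because it is applied to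
  multiplicities as well as to rational coefficients.\<close>

lemma subset_sums_cancel:
  fixes f g :: "'a set \<Rightarrow> 'b::cancel_comm_monoid_add"
  assumes "finite T" "\<And>U. U \<subseteq> T \<Longrightarrow> sum f (Pow U) = sum g (Pow U)"
  shows "f T = g T"
  using assms
proof (induction T rule: finite_psubset_induct)
  case (psubset T)
  have "sum f (Pow T - {T}) = sum g (Pow T - {T})"
    by (rule sum.cong[OF refl], rule psubset.IH) (use psubset.prems in auto)
  moreover have "sum h (Pow T) = h T + sum h (Pow T - {T})" for h :: "'a set \<Rightarrow> 'b"
    using psubset.hyps by (intro sum.remove) auto
  ultimately show ?case
    using psubset.prems[of T] by simp
qed

text \<open>Existence in Moebius inversion, with \<open>a T = (-1) ^ card T * (\<Sum>S\<in>Pow T.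
  (-1) ^ card S * c S)\<close>, one function for all \<open>T\<close>.\<close>

lemma ex_subset_sums:
  fixes c :: "'a set \<Rightarrow> 'b::ring_1"
  shows "\<exists>a. \<forall>T. finite T \<longrightarrow> sum a (Pow T) = c T"
  using inclusion_exclusion_symmetric[of "\<lambda>S. \<Sum>T\<in>Pow S. (-1) ^ card T * c T" c] by metis

text \<open>Each \<open>x\<close> is counted once, at \<open>S = D x\<close>. The right side has the
  shape of a coefficient in a sum of fundamental functions.\<close>

lemma sum_Pow_count_image_mset:
  assumes "finite T"
  shows "(\<Sum>S\<in>Pow T. count (image_mset D M) S) = (\<Sum>x\<in>#M. of_bool (D x \<subseteq> T))"
proof (induction M)
  case (add x M)
  have "(\<Sum>S\<in>Pow T. count (image_mset D (add_mset x M)) S) =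
      (\<Sum>S\<in>Pow T. (if S = D x then 1 else 0) + count (image_mset D M) S)"
    by (intro sum.cong) auto
  then show ?case
    using add assms by (simp add: sum.distrib)
qed simp

section \<open>Invariance under packing, and shuffle-compatibility\<close>

lemma pack_less_iff:
  assumes "i < length \<alpha>" "j < length \<alpha>"
  shows "pack \<alpha> ! i < pack \<alpha> ! j \<longleftrightarrow> \<alpha> ! i < \<alpha> ! j"
proof -
  have less: "card {c \<in> set \<alpha>. c \<le> a} < card {c \<in> set \<alpha>. c \<le> b}" if "a < b" "b \<in> set \<alpha>" for a b
  proof (rule psubset_card_mono)
    have "b \<in> {c \<in> set \<alpha>. c \<le> b} - {c \<in> set \<alpha>. c \<le> a}"
      using that by simp
    moreover have "{c \<in> set \<alpha>. c \<le> a} \<subseteq> {c \<in> set \<alpha>. c \<le> b}"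
      using that by auto
    ultimately show "{c \<in> set \<alpha>. c \<le> a} \<subset> {c \<in> set \<alpha>. c \<le> b}"
      by blast
  qed simp
  show ?thesis
    using assms less[of "\<alpha> ! i" "\<alpha> ! j"] less[of "\<alpha> ! j" "\<alpha> ! i"]
    by (cases "\<alpha> ! i" "\<alpha> ! j" rule: linorder_cases) (auto simp: pack_def)
qed

lemma Des_pack: "Des (pack \<alpha>) = Des \<alpha>"
proof -
  have "length (pack \<alpha>) = length \<alpha>"
    by (simp add: pack_def)
  then show ?thesis
    by (auto simp: Des_def pack_less_iff)
qed

lemma image_mset_Des_Sh_eq:
  assumes dis: "disjoint_words \<alpha> \<beta>" "disjoint_words \<alpha>' \<beta>'"
    and len: "length \<alpha> = length \<alpha>'" "length \<beta> = length \<beta>'"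
    and Des: "Des \<alpha> = Des \<alpha>'" "Des \<beta> = Des \<beta>'"
  shows "image_mset Des (Sh \<alpha> \<beta>) = image_mset Des (Sh \<alpha>' \<beta>')"
proof (rule multiset_eqI)
  fix S
  define n where "n = length \<alpha> + length \<beta>"
  let ?M = "image_mset Des (Sh \<alpha> \<beta>)" and ?M' = "image_mset Des (Sh \<alpha>' \<beta>')"
  have len_Sh: "\<And>\<gamma>. \<gamma> \<in># Sh \<alpha> \<beta> \<Longrightarrow> length \<gamma> = n"
      "\<And>\<gamma>. \<gamma> \<in># Sh \<alpha>' \<beta>' \<Longrightarrow> length \<gamma> = n"
    by (simp_all add: n_def len length_Sh)
  show "count ?M S = count ?M' S"
  proof (cases "S \<subseteq> {1..<n}")
    case True
    have "(\<Sum>S\<in>Pow U. count ?M S) = (\<Sum>S\<in>Pow U. count ?M' S)" if "U \<subseteq> S" for U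
    proof -
      have U: "U \<subseteq> {1..<n}"
        using that True by blast
      then have fin: "finite U"
        by (rule finite_subset) simp
      \<comment> \<open>The coefficient of this monomial counts the shuffles whose descent set lies
        inside \<open>U\<close>.\<close>
      obtain m where m: "total_degree m = n" "comp_set (exponents m) = U"
        using ex_monomial[OF U] by blast
      have coeff: "of_nat (\<Sum>S\<in>Pow U. count (image_mset Des (Sh x y)) S) =
          (\<Sum>\<gamma>\<in>#Sh x y. F (Comp (length \<gamma>) (Des \<gamma>)) m)"
        if "\<And>\<gamma>. \<gamma> \<in># Sh x y \<Longrightarrow> length \<gamma> = n" for x y
        unfolding sum_Pow_count_image_mset[OF fin] of_nat_sum_mset multiset.map_comp comp_def F_Des
        by (intro arg_cong[where f = sum_mset] image_mset_cong) (simp add: m that)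
      have "(of_nat (\<Sum>S\<in>Pow U. count ?M S) :: rat) = of_nat (\<Sum>S\<in>Pow U. count ?M' S)"
        using len_Sh by (simp only: coeff sum_F_Sh[OF dis(1)] sum_F_Sh[OF dis(2)] len Des)
      then show ?thesis
        by (simp only: of_nat_eq_iff)
    qed
    moreover have "finite S"
      using True by (rule finite_subset) simp
    ultimately show ?thesis
      by (intro subset_sums_cancel[of S "count ?M" "count ?M'"])
  next
    case False
    then have "S \<notin># ?M" "S \<notin># ?M'"
      using len_Sh Des_subset by (force simp del: One_nat_def)+
    then show ?thesis
      by (simp only: not_in_iff)
  qed
qed

lemma shuffle_compatible_Des: "shuffle_compatible Des"
  unfolding shuffle_compatible_def
  by (metis image_mset_Des_Sh_eq Des_pack)


section \<open>The linear bijection\<close>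

text \<open>Addresses a class without a representative. The set is empty unless
  \<open>S \<subseteq> {1..<n}\<close>, hence the recurring side condition.\<close>

definition des_class :: "nat \<Rightarrow> nat set \<Rightarrow> word set" where
  "des_class n S = {\<beta> \<in> words. Des \<beta> = S \<and> length \<beta> = n}"

lemma word_class_Des: "word_class Des \<alpha> = des_class (length \<alpha>) (Des \<alpha>)"
  by (auto simp: word_class_def des_class_def)

lemma des_class_nonempty:
  assumes "S \<subseteq> {1..<n}"
  shows "des_class n S \<noteq> {}"
proof -
  have "finite S"
    using assms by (rule finite_subset) simp
  \<comment> \<open>Each letter is one more than the number of elements of \<open>S\<close> still
    ahead, so the word drops exactly at \<open>S\<close>; \<open>Suc\<close> keeps the letters
    positive.\<close>
  define \<alpha> where "\<alpha> = map (\<lambda>i. Suc (card {s \<in> S. i < s})) [0..<n]"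
  have "j \<in> Des \<alpha> \<longleftrightarrow> j \<in> S" if j: "j \<in> {1..<n}" for j
  proof -
    have "{s \<in> S. j - 1 < s} = {s \<in> S. j < s} \<union> ({j} \<inter> S)"
      using j by auto
    also have "card \<dots> = card {s \<in> S. j < s} + card ({j} \<inter> S)"
      using \<open>finite S\<close> by (intro card_Un_disjoint) auto
    finally show ?thesis
      using j by (cases "j \<in> S") (auto simp: Des_def \<alpha>_def)
  qed
  then have "Des \<alpha> = S"
    using assms Des_subset[of \<alpha>] by (auto simp: \<alpha>_def)
  then have "\<alpha> \<in> des_class n S"
    by (auto simp: des_class_def words_def \<alpha>_def)
  then show ?thesis
    by blast
qed

lemma des_class_eq_iff:
  assumes "S \<subseteq> {1..<n}"
  shows "des_class n S = des_class n' S' \<longleftrightarrow> n = n' \<and> S = S'"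
  using des_class_nonempty[OF assms] by (auto simp: des_class_def)

lemma word_classes_Des: "word_class Des ` words = {des_class n S |n S. S \<subseteq> {1..<n}}"
proof -
  have "des_class n S \<in> word_class Des ` words" if "S \<subseteq> {1..<n}" for n S
    using des_class_nonempty[OF that] by (auto simp: word_class_Des des_class_def image_iff)
  moreover have "word_class Des \<alpha> \<in> {des_class n S |n S. S \<subseteq> {1..<n}}" for \<alpha>
    using Des_subset[of \<alpha>] unfolding word_class_Des by blast
  ultimately show ?thesis
    by blast
qed

lemma lookup_scale: "Poly_Mapping.lookup (scale c p) k = c * Poly_Mapping.lookup p k"
  by (simp add: scale_def Poly_Mapping.map.rep_eq when_def)

lemma keys_scale_subset: "Poly_Mapping.keys (scale c p) \<subseteq> Poly_Mapping.keys p"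
  by (auto simp: in_keys_iff lookup_scale)

lemma poly_mapping_eq_sum_scale:
  "p = (\<Sum>C\<in>Poly_Mapping.keys p. scale (Poly_Mapping.lookup p C) (Poly_Mapping.single C 1))"
  by (rule poly_mapping_eqI)
    (simp add: lookup_sum lookup_scale lookup_single when_def in_keys_iff if_distrib cong: if_cong)

text \<open>Summed over the classes this is the expansion of the image of \<open>p\<close>: the coefficient of \<open>m\<close>
  in the fundamental function of \<open>(n, S)\<close> is 1 if \<open>m\<close> has degree \<open>n\<close> and \<open>S\<close> consists of
  partial sums of its exponents, and 0 otherwise.\<close>

definition to_QSym :: "(word set \<Rightarrow>\<^sub>0 rat) \<Rightarrow> power_series" where
  "to_QSym p m =
     (\<Sum>S\<in>Pow (comp_set (exponents m)). Poly_Mapping.lookup p (des_class (total_degree m) S))"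

lemma to_QSym_add: "to_QSym (p + q) m = to_QSym p m + to_QSym q m"
  by (simp add: to_QSym_def lookup_add sum.distrib)

lemma to_QSym_scale: "to_QSym (scale c p) m = c * to_QSym p m"
  by (simp add: to_QSym_def lookup_scale sum_distrib_left)

lemma to_QSym_zero: "to_QSym 0 m = 0"
  by (simp add: to_QSym_def)

lemma to_QSym_sum: "to_QSym (\<Sum>x\<in>A. g x) m = (\<Sum>x\<in>A. to_QSym (g x) m)"
  by (induction A rule: infinite_finite_induct) (simp_all add: to_QSym_add to_QSym_zero)

lemma to_QSym_sum_mset: "to_QSym (\<Sum>x\<in>#A. g x) m = (\<Sum>x\<in>#A. to_QSym (g x) m)"
  by (induction A) (simp_all add: to_QSym_add to_QSym_zero)

lemma to_QSym_expand:
  "to_QSym p m = (\<Sum>C\<in>Poly_Mapping.keys p. Poly_Mapping.lookup p C * to_QSym (Poly_Mapping.single C 1) m)"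
  by (subst poly_mapping_eq_sum_scale) (simp only: to_QSym_sum to_QSym_scale)

lemma finite_comp_set [simp]: "finite (comp_set as)"
  by (simp add: comp_set_def)

lemma to_QSym_basis: "to_QSym (basis Des \<alpha>) = F (Comp (length \<alpha>) (Des \<alpha>))"
proof
  fix m
  have "to_QSym (basis Des \<alpha>) m =
      (\<Sum>S\<in>Pow (comp_set (exponents m)). if S = Des \<alpha> then of_bool (total_degree m = length \<alpha>) else 0)"
    unfolding to_QSym_def basis_def word_class_Des
    using des_class_eq_iff[OF Des_subset]
    by (intro sum.cong refl) (auto simp: lookup_single when_def)
  then show "to_QSym (basis Des \<alpha>) m = F (Comp (length \<alpha>) (Des \<alpha>)) m"
    by (simp add: F_Des)
qed

lemma to_QSym_in_QSym: "to_QSym p \<in> carrier QSym"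
proof -
  \<comment> \<open>All words of a class have the same length, so any of them gives its degree; the
    sum over the support is a crude bound for these degrees.\<close>
  define len where "len C = length (SOME \<alpha>. \<alpha> \<in> C)" for C :: "word set"
  have "total_degree m \<le> (\<Sum>C\<in>Poly_Mapping.keys p. len C)" if "to_QSym p m \<noteq> 0" for m
  proof -
    obtain S where S: "S \<subseteq> comp_set (exponents m)"
        "des_class (total_degree m) S \<in> Poly_Mapping.keys p"
      using sum.not_neutral_contains_not_neutral[OF \<open>to_QSym p m \<noteq> 0\<close>[unfolded to_QSym_def]]
      by (auto simp: in_keys_iff)
    then have "(SOME \<alpha>. \<alpha> \<in> des_class (total_degree m) S) \<in> des_class (total_degree m) S"
      using des_class_nonempty comp_set_exponents by (metis some_in_eq subset_trans)
    then have "len (des_class (total_degree m) S) = total_degree m"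
      by (simp add: len_def des_class_def)
    moreover have "len (des_class (total_degree m) S) \<le> (\<Sum>C\<in>Poly_Mapping.keys p. len C)"
      using S(2) by (intro member_le_sum) simp_all
    ultimately show ?thesis
      by simp
  qed
  moreover have "to_QSym p m = to_QSym p m'" if "exponents m = exponents m'" for m m'
    using that total_degree_eq[OF that] by (simp add: to_QSym_def)
  ultimately have "bounded_degree (to_QSym p)" "quasisymmetric (to_QSym p)"
    unfolding bounded_degree_def quasisymmetric_iff by blast+
  then show ?thesis
    by (simp add: QSym_def)
qed

lemma inj_on_to_QSym: "inj_on to_QSym (carrier (word_algebra Des))"
proof (rule inj_onI)
  fix p q
  assume pq: "p \<in> carrier (word_algebra Des)" "q \<in> carrier (word_algebra Des)" "to_QSym p = to_QSym q"
  have eq: "Poly_Mapping.lookup p (des_class n T) = Poly_Mapping.lookup q (des_class n T)"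
    if T: "T \<subseteq> {1..<n}" for n T
  proof (rule subset_sums_cancel[where f = "\<lambda>S. Poly_Mapping.lookup p (des_class n S)"
        and g = "\<lambda>S. Poly_Mapping.lookup q (des_class n S)"])
    show "finite T"
      using T by (rule finite_subset) simp
    fix U assume "U \<subseteq> T"
    with T have "U \<subseteq> {1..<n}"
      by blast
    \<comment> \<open>At this monomial \<open>to_QSym\<close> sums the coefficients of exactly the
      subsets of \<open>U\<close>.\<close>
    then obtain m where "total_degree m = n" "comp_set (exponents m) = U"
      by (rule ex_monomial)
    then show "(\<Sum>S\<in>Pow U. Poly_Mapping.lookup p (des_class n S)) =
        (\<Sum>S\<in>Pow U. Poly_Mapping.lookup q (des_class n S))"
      using fun_cong[OF pq(3), of m] by (simp add: to_QSym_def)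
  qed
  show "p = q"
  proof (rule poly_mapping_eqI)
    fix C
    show "Poly_Mapping.lookup p C = Poly_Mapping.lookup q C"
    proof (cases "C \<in> word_class Des ` words")
      case True
      then show ?thesis
        using eq by (auto simp: word_classes_Des)
    next
      case False
      then have "C \<notin> Poly_Mapping.keys p" "C \<notin> Poly_Mapping.keys q"
        using pq(1,2) by (auto simp: word_algebra_def)
      then show ?thesis
        by (simp add: in_keys_iff)
    qed
  qed
qed

lemma to_QSym_surj:
  assumes "f \<in> carrier QSym"
  shows "\<exists>p\<in>carrier (word_algebra Des). to_QSym p = f"
proof -
  obtain d where d: "\<And>m. f m \<noteq> 0 \<Longrightarrow> total_degree m \<le> d" and qs: "quasisymmetric f"
    using assms by (auto simp: QSym_def bounded_degree_def)
  \<comment> \<open>The common coefficient in \<open>f\<close> of all monomials with these data; an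
    arbitrary value if there are none.\<close>
  define c where "c n T = f (SOME m. total_degree m = n \<and> comp_set (exponents m) = T)" for n T
  have "\<forall>n. \<exists>a. \<forall>T. finite T \<longrightarrow> sum a (Pow T) = c n T"
    using ex_subset_sums by blast
  then obtain a where a: "\<And>n T. finite T \<Longrightarrow> sum (a n) (Pow T) = c n T"
    by metis
  define p where "p = (\<Sum>n\<le>d. \<Sum>S\<in>Pow {1..<n}. Poly_Mapping.single (des_class n S) (a n S))"
  have lookup_p: "Poly_Mapping.lookup p (des_class n S) = (if n \<le> d then a n S else 0)"
    if S: "S \<subseteq> {1..<n}" for n S
  proof -
    have eq: "des_class n' S' = des_class n S \<longleftrightarrow> n' = n \<and> S' = S" for n' S'
      using des_class_eq_iff[OF S] by metis
    have "Poly_Mapping.lookup p (des_class n S) =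
        (\<Sum>n'\<le>d. \<Sum>S'\<in>Pow {1..<n'}. if n' = n then (if S' = S then a n S else 0) else 0)"
      unfolding p_def lookup_sum
      by (intro sum.cong refl) (auto simp: lookup_single when_def eq)
    also have "\<dots> = (\<Sum>n'\<le>d. if n' = n then \<Sum>S'\<in>Pow {1..<n}. if S' = S then a n S else 0 else 0)"
      by (intro sum.cong refl) auto
    also have "\<dots> = (if n \<le> d then a n S else 0)"
      using S by (simp add: sum.delta)
    finally show ?thesis .
  qed
  have "to_QSym p m = f m" for m
  proof -
    let ?n = "total_degree m" and ?T = "comp_set (exponents m)"
    have "to_QSym p m = (\<Sum>S\<in>Pow ?T. if ?n \<le> d then a ?n S else 0)"
      unfolding to_QSym_def using comp_set_exponents[of m] by (intro sum.cong refl lookup_p) blast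
    also have "\<dots> = (if ?n \<le> d then c ?n ?T else 0)"
      by (simp add: a)
    \<comment> \<open>By quasisymmetry the monomial chosen in \<open>c\<close> does not matter, and
      \<open>m\<close> itself shows that one exists.\<close>
    also have "c ?n ?T = f m"
      unfolding c_def
      by (rule quasisymmetric_eqI[OF qs]; rule someI2[of _ m]) simp_all
    \<comment> \<open>Beyond degree \<open>d\<close> both sides vanish.\<close>
    finally show ?thesis
      using d[of m] by auto
  qed
  moreover have "p \<in> carrier (word_algebra Des)"
  proof -
    have "Poly_Mapping.keys p \<subseteq>
        (\<Union>n\<le>d. \<Union>S\<in>Pow {1..<n}. Poly_Mapping.keys (Poly_Mapping.single (des_class n S) (a n S)))"
      unfolding p_def by (rule order_trans[OF keys_sum UN_mono[OF order_refl keys_sum]])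
    also have "\<dots> \<subseteq> word_class Des ` words"
    proof (intro UN_least)
      fix n :: nat and S assume "S \<in> Pow {1..<n}"
      then have "des_class n S \<in> word_class Des ` words"
        unfolding word_classes_Des by blast
      then show "Poly_Mapping.keys (Poly_Mapping.single (des_class n S) (a n S)) \<subseteq> word_class Des ` words"
        by simp
    qed
    finally show ?thesis
      by (simp add: word_algebra_def)
  qed
  ultimately show ?thesis
    by blast
qed


section \<open>Algebra structures\<close>

lemma disjoint_representative:
  assumes "\<alpha> \<in> words" "\<beta> \<in> words"
  obtains \<beta>' where "\<beta>' \<in> words" "word_class Des \<beta>' = word_class Des \<beta>" "disjoint_words \<alpha> \<beta>'"
proof
  \<comment> \<open>No letter of \<open>\<alpha>\<close> exceeds its sum and the letters of
    \<open>\<beta>\<close> are positive, so the shifted word lies above \<open>\<alpha>\<close>;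
    comparisons are preserved.\<close>
  let ?\<beta> = "map ((+) (sum_list \<alpha>)) \<beta>"
  show "?\<beta> \<in> words"
    using assms(2) by (auto simp: words_def)
  have "Des ?\<beta> = Des \<beta>"
    by (auto simp: Des_def)
  then show "word_class Des ?\<beta> = word_class Des \<beta>"
    by (simp add: word_class_Des)
  have "a \<noteq> sum_list \<alpha> + b" if "a \<in> set \<alpha>" "b \<in> set \<beta>" for a b
    using member_le_sum_list[OF that(1)] that(2) assms(2) by (fastforce simp: words_def)
  then show "disjoint_words \<alpha> ?\<beta>"
    by (auto simp: disjoint_words_def)
qed

lemma class_prod_Des:
  assumes "C \<in> word_class Des ` words" "D \<in> word_class Des ` words"
  obtains \<alpha> \<beta> where "\<alpha> \<in> words" "\<beta> \<in> words" "disjoint_words \<alpha> \<beta>"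
    "C = word_class Des \<alpha>" "D = word_class Des \<beta>"
    "class_prod Des C D = (\<Sum>\<gamma>\<in>#Sh \<alpha> \<beta>. basis Des \<gamma>)"
proof -
  obtain \<alpha> \<beta> where ab: "\<alpha> \<in> words" "\<beta> \<in> words" "C = word_class Des \<alpha>" "D = word_class Des \<beta>"
    using assms by blast
  obtain \<beta>' where b': "\<beta>' \<in> words" "word_class Des \<beta>' = word_class Des \<beta>" "disjoint_words \<alpha> \<beta>'"
    by (rule disjoint_representative[OF ab(1,2)])
  show ?thesis
    using that[of \<alpha> \<beta>'] class_prod_eq[OF shuffle_compatible_Des ab(1) b'(1,3)] ab b' by simp
qed

lemma to_QSym_class_prod:
  assumes "C \<in> word_class Des ` words" "D \<in> word_class Des ` words"
  shows "to_QSym (class_prod Des C D) m =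
    (\<Sum>(a, b) | a + b = m. to_QSym (Poly_Mapping.single C 1) a * to_QSym (Poly_Mapping.single D 1) b)"
proof -
  obtain \<alpha> \<beta> where *: "disjoint_words \<alpha> \<beta>" "C = word_class Des \<alpha>" "D = word_class Des \<beta>"
    "class_prod Des C D = (\<Sum>\<gamma>\<in>#Sh \<alpha> \<beta>. basis Des \<gamma>)"
    by (rule class_prod_Des[OF assms])
  then show ?thesis
    by (simp only: to_QSym_sum_mset to_QSym_basis sum_F_Sh basis_def[symmetric])
qed

lemma to_QSym_mult:
  assumes "p \<in> carrier (word_algebra Des)" "q \<in> carrier (word_algebra Des)"
  shows "to_QSym (p \<otimes>\<^bsub>word_algebra Des\<^esub> q) = to_QSym p \<otimes>\<^bsub>QSym\<^esub> to_QSym q"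
proof
  fix m
  let ?k = Poly_Mapping.keys and ?l = Poly_Mapping.lookup
  let ?s = "\<lambda>C. to_QSym (Poly_Mapping.single C 1)"
  have "to_QSym (p \<otimes>\<^bsub>word_algebra Des\<^esub> q) m =
      (\<Sum>C\<in>?k p. \<Sum>D\<in>?k q. ?l p C * ?l q D * to_QSym (class_prod Des C D) m)"
    by (simp add: word_algebra_def to_QSym_sum to_QSym_scale)
  also have "\<dots> = (\<Sum>C\<in>?k p. \<Sum>D\<in>?k q. \<Sum>(a, b) | a + b = m.
      (?l p C * ?s C a) * (?l q D * ?s D b))"
  proof (intro sum.cong refl)
    fix C D assume "C \<in> ?k p" "D \<in> ?k q"
    then have "C \<in> word_class Des ` words" "D \<in> word_class Des ` words"
      using assms by (auto simp: word_algebra_def)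
    then show "?l p C * ?l q D * to_QSym (class_prod Des C D) m =
        (\<Sum>(a, b) | a + b = m. (?l p C * ?s C a) * (?l q D * ?s D b))"
      by (simp add: to_QSym_class_prod sum_distrib_left case_prod_unfold mult_ac)
  qed
  also have "\<dots> = (\<Sum>(a, b) | a + b = m. \<Sum>C\<in>?k p. \<Sum>D\<in>?k q.
      (?l p C * ?s C a) * (?l q D * ?s D b))"
    unfolding case_prod_unfold by (subst sum.swap, rule sum.cong[OF refl], rule sum.swap)
  also have "\<dots> = (\<Sum>(a, b) | a + b = m. to_QSym p a * to_QSym q b)"
    by (simp only: to_QSym_expand[of p] to_QSym_expand[of q] sum_product)
  finally show "to_QSym (p \<otimes>\<^bsub>word_algebra Des\<^esub> q) m = (to_QSym p \<otimes>\<^bsub>QSym\<^esub> to_QSym q) m"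
    by (simp add: QSym_def)
qed

lemma keys_sum_mset_basis:
  assumes "\<And>\<gamma>. \<gamma> \<in># M \<Longrightarrow> \<gamma> \<in> words"
  shows "Poly_Mapping.keys (\<Sum>\<gamma>\<in>#M. basis st \<gamma>) \<subseteq> word_class st ` words"
  using assms
proof (induction M)
  case (add \<gamma> M)
  have "Poly_Mapping.keys (basis st \<gamma> + (\<Sum>\<gamma>\<in>#M. basis st \<gamma>)) \<subseteq>
      Poly_Mapping.keys (basis st \<gamma>) \<union> Poly_Mapping.keys (\<Sum>\<gamma>\<in>#M. basis st \<gamma>)"
    by (rule keys_add)
  moreover have "Poly_Mapping.keys (basis st \<gamma>) \<subseteq> word_class st ` words"
    using add.prems[of \<gamma>] by (simp add: basis_def)
  ultimately show ?case
    using add by auto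
qed simp

text \<open>Closure cannot be transported along an injective map, so it is checked on
  supports.\<close>

lemma word_algebra_mult_closed:
  assumes "p \<in> carrier (word_algebra Des)" "q \<in> carrier (word_algebra Des)"
  shows "p \<otimes>\<^bsub>word_algebra Des\<^esub> q \<in> carrier (word_algebra Des)"
proof -
  let ?k = "Poly_Mapping.keys" and ?W = "word_class Des ` words"
  have "?k (class_prod Des C D) \<subseteq> ?W" if "C \<in> ?k p" "D \<in> ?k q" for C D
  proof -
    have "C \<in> ?W" "D \<in> ?W"
      using that assms by (auto simp: word_algebra_def)
    then obtain \<alpha> \<beta> where *: "\<alpha> \<in> words" "\<beta> \<in> words"
      "class_prod Des C D = (\<Sum>\<gamma>\<in>#Sh \<alpha> \<beta>. basis Des \<gamma>)"
      by (rule class_prod_Des)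
    show ?thesis
      unfolding *(3) by (rule keys_sum_mset_basis) (rule words_Sh[OF *(1,2)])
  qed
  then have "?k (scale c (class_prod Des C D)) \<subseteq> ?W" if "C \<in> ?k p" "D \<in> ?k q" for c C D
    using that keys_scale_subset by (metis order_trans)
  then have "?k (\<Sum>C\<in>?k p. \<Sum>D\<in>?k q. scale (Poly_Mapping.lookup p C * Poly_Mapping.lookup q D)
      (class_prod Des C D)) \<subseteq> ?W"
    by (intro order_trans[OF keys_sum] UN_least)
  then show ?thesis
    by (simp add: word_algebra_def)
qed

lemma to_QSym_one: "to_QSym \<one>\<^bsub>word_algebra Des\<^esub> = \<one>\<^bsub>QSym\<^esub>"
proof -
  have "total_degree m = 0 \<longleftrightarrow> m = 0" for m
    by (auto simp: total_degree_def in_keys_iff poly_mapping_eq_iff fun_eq_iff)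
  then have "F (Comp (length ([] :: word)) (Des [])) m = (if m = 0 then 1 else 0)" for m
    unfolding F_Des by (auto simp: Des_def)
  then show ?thesis
    by (auto simp: word_algebra_def QSym_def to_QSym_basis)
qed

lemma to_QSym_linear: "to_QSym \<in> linear_maps rat_ring (word_algebra Des) QSym"
  using to_QSym_in_QSym
  by (auto simp: linear_maps_def word_algebra_def QSym_def to_QSym_add to_QSym_scale)

section \<open>Algebra axioms for power series and for words\<close>

lemma cring_rat_ring: "cring rat_ring"
proof (intro cringI abelian_groupI comm_monoidI)
  fix x assume "x \<in> carrier rat_ring"
  have "- x \<in> carrier rat_ring" "- x \<oplus>\<^bsub>rat_ring\<^esub> x = \<zero>\<^bsub>rat_ring\<^esub>"
    by (simp_all add: rat_ring_def)
  then show "\<exists>y\<in>carrier rat_ring. y \<oplus>\<^bsub>rat_ring\<^esub> x = \<zero>\<^bsub>rat_ring\<^esub>"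
    by blast
qed (simp_all add: rat_ring_def algebra_simps)

text \<open>Closure under the operations is read off the surjection from the word algebra.\<close>

lemma QSym_mult_closed:
  assumes "f \<in> carrier QSym" "g \<in> carrier QSym"
  shows "f \<otimes>\<^bsub>QSym\<^esub> g \<in> carrier QSym"
  using to_QSym_surj[OF assms(1)] to_QSym_surj[OF assms(2)] to_QSym_mult to_QSym_in_QSym by metis

lemma QSym_mult_assoc:
  "f \<otimes>\<^bsub>QSym\<^esub> g \<otimes>\<^bsub>QSym\<^esub> h = f \<otimes>\<^bsub>QSym\<^esub> (g \<otimes>\<^bsub>QSym\<^esub> h)"
proof
  fix m
  let ?P = "\<lambda>x :: monomial. {(a, b). a + b = x}"
  note fin = finite_monomial_factorizations
  have "(f \<otimes>\<^bsub>QSym\<^esub> g \<otimes>\<^bsub>QSym\<^esub> h) m = (\<Sum>p\<in>?P m. \<Sum>q\<in>?P (fst p). f (fst q) * g (snd q) * h (snd p))"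
    by (simp add: QSym_def case_prod_unfold sum_distrib_right)
  also have "\<dots> = (\<Sum>(p, q)\<in>Sigma (?P m) (\<lambda>p. ?P (fst p)). f (fst q) * g (snd q) * h (snd p))"
    by (rule sum.Sigma) (simp_all add: fin)
  \<comment> \<open>Both sides run over the triples with \<open>a + b + c = m\<close>, grouped once
    as \<open>(a + b, c)\<close> and once as \<open>(a, b + c)\<close>.\<close>
  also have "\<dots> = (\<Sum>(p, q)\<in>Sigma (?P m) (\<lambda>p. ?P (snd p)). f (fst p) * (g (fst q) * h (snd q)))"
    by (rule sum.reindex_bij_witness[of _
          "\<lambda>((a, y), (b, c)). ((a + b, c), (a, b))" "\<lambda>((x, c), (a, b)). ((a, b + c), (b, c))"])
      (auto simp: add_ac mult_ac)
  also have "\<dots> = (\<Sum>p\<in>?P m. \<Sum>q\<in>?P (snd p). f (fst p) * (g (fst q) * h (snd q)))"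
    by (rule sum.Sigma[symmetric]) (simp_all add: fin)
  also have "\<dots> = (f \<otimes>\<^bsub>QSym\<^esub> (g \<otimes>\<^bsub>QSym\<^esub> h)) m"
    by (simp add: QSym_def case_prod_unfold sum_distrib_left)
  finally show "(f \<otimes>\<^bsub>QSym\<^esub> g \<otimes>\<^bsub>QSym\<^esub> h) m = (f \<otimes>\<^bsub>QSym\<^esub> (g \<otimes>\<^bsub>QSym\<^esub> h)) m" .
qed

lemma QSym_mult_commute: "f \<otimes>\<^bsub>QSym\<^esub> g = g \<otimes>\<^bsub>QSym\<^esub> f"
proof
  fix m
  have "(\<Sum>(a, b) | a + b = m. f a * g b) = (\<Sum>(a, b) | a + b = m. g a * f b)"
    by (rule sum.reindex_bij_witness[of _ prod.swap prod.swap]) (auto simp: add_ac mult_ac)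
  then show "(f \<otimes>\<^bsub>QSym\<^esub> g) m = (g \<otimes>\<^bsub>QSym\<^esub> f) m"
    by (simp add: QSym_def)
qed

lemma QSym_mult_one: "\<one>\<^bsub>QSym\<^esub> \<otimes>\<^bsub>QSym\<^esub> f = f"
proof
  fix m
  have "(\<Sum>(a, b) | a + b = m. (if a = 0 then 1 else 0) * f b) =
      (\<Sum>x | fst x + snd x = m. if x = (0, m) then f m else 0)"
    by (rule sum.cong) (auto split: if_splits)
  then show "(\<one>\<^bsub>QSym\<^esub> \<otimes>\<^bsub>QSym\<^esub> f) m = f m"
    using finite_monomial_factorizations[of m] by (simp add: QSym_def case_prod_unfold)
qed

lemma QSym_add_closed:
  assumes "f \<in> carrier QSym" "g \<in> carrier QSym"
  shows "f \<oplus>\<^bsub>QSym\<^esub> g \<in> carrier QSym"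
proof -
  obtain p q where "f = to_QSym p" "g = to_QSym q"
    using to_QSym_surj assms by metis
  then have "f \<oplus>\<^bsub>QSym\<^esub> g = to_QSym (p + q)"
    by (simp add: QSym_def to_QSym_add fun_eq_iff)
  then show ?thesis
    by (simp add: to_QSym_in_QSym)
qed

lemma QSym_smult_closed:
  assumes "f \<in> carrier QSym"
  shows "c \<odot>\<^bsub>QSym\<^esub> f \<in> carrier QSym"
proof -
  obtain p where "f = to_QSym p"
    using to_QSym_surj assms by metis
  then have "c \<odot>\<^bsub>QSym\<^esub> f = to_QSym (scale c p)"
    by (simp add: QSym_def to_QSym_scale fun_eq_iff)
  then show ?thesis
    by (simp add: to_QSym_in_QSym)
qed

lemma algebra_QSym: "algebra rat_ring QSym"
proof (intro algebraI[OF cring_rat_ring] cringI abelian_groupI comm_monoidI)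
  show "\<zero>\<^bsub>QSym\<^esub> \<in> carrier QSym"
    by (simp add: QSym_def bounded_degree_def quasisymmetric_def)
  show "\<one>\<^bsub>QSym\<^esub> \<in> carrier QSym"
    using to_QSym_in_QSym to_QSym_one by metis
  fix f assume f: "f \<in> carrier QSym"
  have "(-1) \<odot>\<^bsub>QSym\<^esub> f \<oplus>\<^bsub>QSym\<^esub> f = \<zero>\<^bsub>QSym\<^esub>"
    by (simp add: QSym_def)
  then show "\<exists>g\<in>carrier QSym. g \<oplus>\<^bsub>QSym\<^esub> f = \<zero>\<^bsub>QSym\<^esub>"
    using QSym_smult_closed[OF f] by blast
next
  fix f g h
  show "(f \<oplus>\<^bsub>QSym\<^esub> g) \<otimes>\<^bsub>QSym\<^esub> h = f \<otimes>\<^bsub>QSym\<^esub> h \<oplus>\<^bsub>QSym\<^esub> g \<otimes>\<^bsub>QSym\<^esub> h"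
    by (simp add: QSym_def case_prod_unfold distrib_right sum.distrib)
  show "(c \<odot>\<^bsub>QSym\<^esub> f) \<otimes>\<^bsub>QSym\<^esub> g = c \<odot>\<^bsub>QSym\<^esub> (f \<otimes>\<^bsub>QSym\<^esub> g)" for c
    by (simp add: QSym_def case_prod_unfold sum_distrib_left mult_ac)
qed (simp_all add: QSym_add_closed QSym_smult_closed QSym_mult_closed QSym_mult_assoc QSym_mult_one,
    simp_all add: QSym_mult_commute, simp_all add: QSym_def rat_ring_def algebra_simps)

text \<open>Apart from closure and negatives, each axiom is an equation: apply \<open>h\<close>, use
  the axiom in \<open>B\<close>, and cancel \<open>h\<close> by injectivity.\<close>

lemma algebra_of_inj_hom:
  fixes R (structure) and A (structure) and B (structure)
  assumes "algebra R B" and h: "h \<in> linear_maps R A B" and inj: "inj_on h (carrier A)"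
    and closed: "\<zero>\<^bsub>A\<^esub> \<in> carrier A" "\<one>\<^bsub>A\<^esub> \<in> carrier A"
      "\<And>x y. x \<in> carrier A \<Longrightarrow> y \<in> carrier A \<Longrightarrow> x \<oplus>\<^bsub>A\<^esub> y \<in> carrier A"
      "\<And>x y. x \<in> carrier A \<Longrightarrow> y \<in> carrier A \<Longrightarrow> x \<otimes>\<^bsub>A\<^esub> y \<in> carrier A"
      "\<And>c x. c \<in> carrier R \<Longrightarrow> x \<in> carrier A \<Longrightarrow> c \<odot>\<^bsub>A\<^esub> x \<in> carrier A"
    and hom: "h \<zero>\<^bsub>A\<^esub> = \<zero>\<^bsub>B\<^esub>" "h \<one>\<^bsub>A\<^esub> = \<one>\<^bsub>B\<^esub>"
      "\<And>x y. x \<in> carrier A \<Longrightarrow> y \<in> carrier A \<Longrightarrow> h (x \<otimes>\<^bsub>A\<^esub> y) = h x \<otimes>\<^bsub>B\<^esub> h y"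
  shows "algebra R A"
proof -
  interpret B: algebra R B
    by fact
  have hcl: "h x \<in> carrier B" if "x \<in> carrier A" for x
    using h that by (auto simp: linear_maps_def)
  have hadd: "h (x \<oplus>\<^bsub>A\<^esub> y) = h x \<oplus>\<^bsub>B\<^esub> h y" if "x \<in> carrier A" "y \<in> carrier A" for x y
    using h that by (auto simp: linear_maps_def)
  have hsm: "h (c \<odot>\<^bsub>A\<^esub> x) = c \<odot>\<^bsub>B\<^esub> h x" if "c \<in> carrier R" "x \<in> carrier A" for c x
    using h that by (auto simp: linear_maps_def)
  note eqI = inj_onD[OF inj]
  show ?thesis
  proof (intro algebraI[OF B.R_cring] cringI abelian_groupI comm_monoidI)
    fix x assume x: "x \<in> carrier A"
    \<comment> \<open>The negative must lie in \<open>A\<close>; scaling by minus one provides it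
      through closure.\<close>
    have "\<ominus> \<one> \<odot>\<^bsub>A\<^esub> x \<oplus>\<^bsub>A\<^esub> x = \<zero>\<^bsub>A\<^esub>"
      by (rule eqI) (simp_all add: x closed hom hcl hadd hsm B.smult_l_minus B.M.l_neg)
    then show "\<exists>y\<in>carrier A. y \<oplus>\<^bsub>A\<^esub> x = \<zero>\<^bsub>A\<^esub>"
      using x closed(5) by blast
  next
    fix x y assume "x \<in> carrier A" "y \<in> carrier A"
    then show "x \<oplus>\<^bsub>A\<^esub> y = y \<oplus>\<^bsub>A\<^esub> x"
      by (intro eqI) (simp_all add: closed hcl hadd B.M.a_comm)
  next
    fix x y assume "x \<in> carrier A" "y \<in> carrier A"
    then show "x \<otimes>\<^bsub>A\<^esub> y = y \<otimes>\<^bsub>A\<^esub> x"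
      by (intro eqI) (simp_all add: closed hcl hom B.m_comm)
  qed (rule eqI | simp add: closed hom hcl hadd hsm B.M.a_assoc B.m_assoc B.l_distr
      B.smult_l_distr B.smult_r_distr B.smult_assoc1 B.smult_assoc2)+
qed

lemma algebra_word_algebra_Des: "algebra rat_ring (word_algebra Des)"
proof (rule algebra_of_inj_hom[OF algebra_QSym to_QSym_linear inj_on_to_QSym])
  show "\<one>\<^bsub>word_algebra Des\<^esub> \<in> carrier (word_algebra Des)"
    by (simp add: word_algebra_def basis_def words_def)
  show "to_QSym \<zero>\<^bsub>word_algebra Des\<^esub> = \<zero>\<^bsub>QSym\<^esub>"
    by (simp add: word_algebra_def QSym_def to_QSym_zero fun_eq_iff)
  show "x \<oplus>\<^bsub>word_algebra Des\<^esub> y \<in> carrier (word_algebra Des)"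
    if "x \<in> carrier (word_algebra Des)" "y \<in> carrier (word_algebra Des)" for x y
    using that keys_add[of x y] by (auto simp: word_algebra_def)
  show "c \<odot>\<^bsub>word_algebra Des\<^esub> x \<in> carrier (word_algebra Des)"
    if "x \<in> carrier (word_algebra Des)" for c x
    using that keys_scale_subset[of c x] by (auto simp: word_algebra_def)
qed (simp_all add: word_algebra_mult_closed to_QSym_one to_QSym_mult, simp add: word_algebra_def)

text \<open>Linearity is known on the carrier only, so the induction over the support also has to
  keep the partial sums inside it.\<close>

lemma linear_eq_to_QSym:
  assumes lin: "\<phi> \<in> linear_maps rat_ring (word_algebra Des) QSym"
    and basis: "\<forall>\<alpha>\<in>words. \<phi> (basis Des \<alpha>) = F (Comp (length \<alpha>) (Des \<alpha>))"
    and p: "p \<in> carrier (word_algebra Des)"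
  shows "\<phi> p = to_QSym p"
proof -
  let ?W = "word_class Des ` words" and ?s = "\<lambda>c C. scale c (Poly_Mapping.single C 1)"
  let ?A = "{p. Poly_Mapping.keys p \<subseteq> ?W}"
  have add: "\<phi> (x + y) = (\<lambda>m. \<phi> x m + \<phi> y m)" if "x \<in> ?A" "y \<in> ?A" for x y
    using lin that by (auto simp: linear_maps_def word_algebra_def QSym_def)
  have scale: "\<phi> (scale c x) = (\<lambda>m. c * \<phi> x m)" if "x \<in> ?A" for c x
    using lin that by (auto simp: linear_maps_def word_algebra_def QSym_def rat_ring_def)
  have single: "\<phi> (Poly_Mapping.single C 1) = to_QSym (Poly_Mapping.single C 1)" if "C \<in> ?W" for C
    using that basis to_QSym_basis by (auto simp: basis_def)
  have s: "?s c C \<in> ?A" if "C \<in> ?W" for c C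
    using that keys_scale_subset[of c "Poly_Mapping.single C 1"] by auto
  have "\<phi> (\<Sum>C\<in>X. ?s (c C) C) = to_QSym (\<Sum>C\<in>X. ?s (c C) C)" if "finite X" "X \<subseteq> ?W" for X c
    using that
  proof (induction X)
    case empty
    have "scale 0 0 = (0 :: word set \<Rightarrow>\<^sub>0 rat)"
      by (rule poly_mapping_eqI) (simp add: lookup_scale)
    \<comment> \<open>\<open>linear_maps\<close> does not mention zero; scaling zero by zero gives
      its image.\<close>
    then have "\<phi> 0 = (\<lambda>m. 0)"
      using scale[of 0 0] by simp
    then show ?case
      by (simp add: to_QSym_zero fun_eq_iff)
  next
    case (insert C X)
    have "Poly_Mapping.keys (\<Sum>C\<in>X. ?s (c C) C) \<subseteq> ?W"
      by (intro order_trans[OF keys_sum] UN_least) (use insert.prems s in blast)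
    then show ?case
      using insert s[of C] by (simp add: add scale single to_QSym_add to_QSym_scale fun_eq_iff)
  qed
  from this[of "Poly_Mapping.keys p" "Poly_Mapping.lookup p"] show ?thesis
    using p by (simp add: word_algebra_def flip: poly_mapping_eq_sum_scale)
qed

theorem theorem3p7:
  shows "shuffle_compatible Des \<and>
    (\<exists>\<phi>. \<phi> \<in> linear_maps rat_ring (word_algebra Des) QSym \<and>
          (\<forall>\<alpha>\<in>words. \<phi> (basis Des \<alpha>) = F (Comp (length \<alpha>) (Des \<alpha>)))) \<and>
    (\<forall>\<phi>. \<phi> \<in> linear_maps rat_ring (word_algebra Des) QSym \<and>
          (\<forall>\<alpha>\<in>words. \<phi> (basis Des \<alpha>) = F (Comp (length \<alpha>) (Des \<alpha>))) \<longrightarrow>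
          \<phi> \<in> algebra_iso rat_ring (word_algebra Des) QSym)"
proof (intro conjI allI impI)
  show "shuffle_compatible Des"
    by (rule shuffle_compatible_Des)
  show "\<exists>\<phi>. \<phi> \<in> linear_maps rat_ring (word_algebra Des) QSym \<and>
      (\<forall>\<alpha>\<in>words. \<phi> (basis Des \<alpha>) = F (Comp (length \<alpha>) (Des \<alpha>)))"
    using to_QSym_linear to_QSym_basis by blast
next
  let ?A = "word_algebra Des"
  fix \<phi>
  assume \<phi>: "\<phi> \<in> linear_maps rat_ring ?A QSym \<and>
    (\<forall>\<alpha>\<in>words. \<phi> (basis Des \<alpha>) = F (Comp (length \<alpha>) (Des \<alpha>)))"
  \<comment> \<open>Off the carrier \<open>\<phi>\<close> is arbitrary, so agreement is claimed on
    the carrier only.\<close>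
  then have eq: "\<phi> p = to_QSym p" if "p \<in> carrier ?A" for p
    using that linear_eq_to_QSym by blast
  \<comment> \<open>Supplies closure of the carrier, so that \<open>eq\<close> applies to products
    and to the unit.\<close>
  interpret A: algebra rat_ring ?A
    by (rule algebra_word_algebra_Des)
  have "bij_betw to_QSym (carrier ?A) (carrier QSym)"
    unfolding bij_betw_def using inj_on_to_QSym to_QSym_in_QSym to_QSym_surj by blast
  then have "bij_betw \<phi> (carrier ?A) (carrier QSym)"
    using eq by (simp cong: bij_betw_cong)
  moreover have "\<phi> \<in> ring_hom ?A QSym"
    using \<phi> by (intro ring_hom_memI)
      (auto simp: eq to_QSym_in_QSym to_QSym_mult to_QSym_one linear_maps_def)
  ultimately have "\<phi> \<in> ring_iso ?A QSym"
    by (simp add: ring_iso_def)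
  then show "\<phi> \<in> algebra_iso rat_ring ?A QSym"
    using \<phi> algebra_word_algebra_Des algebra_QSym by (simp add: algebra_iso_def)
qed

end
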